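(* Let $\Omega\subseteq\mathbb{R}^n$ be open, let $\nu,C_1,\dots,C_{n-1}\in\mathcal{C}^\infty(\Omega,\mathbb{R})$, put $H:=C_{n-1}$, and let $X$ be the vector field on $\Omega$ with components $X_i=\nu\cdot\frac{\partial(C_1,\dots,C_{n-2},x_i,H)}{\partial(x_1,\dots,x_n)}$, $i=1,\dots,n$. Let $\overline{x}_e\in\mathcal{E}^{C_{n-1}}_{C_1,\dots,C_{n-2}}$ be a non-degenerate regular equilibrium point of $X$, and let $\mathcal{I}_X(\overline{x}_e)$ be the associated scalar quantity. Then: (1) if $\mathcal{I}_X(\overline{x}_e)<0$, the equilibrium $\overline{x}_e$ of $X$ is unstable; (2) if $\mathcal{I}_X(\overline{x}_e)>0$, the equilibrium $\overline{x}_e$ of $X$ is Lyapunov stable.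
   Context: $\langle\cdot,\cdot\rangle$ is the standard inner product on $\mathbb{R}^n$ and $\nabla$ the corresponding gradient. $\frac{\partial(C_1,\dots,C_{n-2},x_i,H)}{\partial(x_1,\dots,x_n)}$ denotes the Jacobian determinant of the map $(C_1,\dots,C_{n-2},x_i,H):\Omega\to\mathbb{R}^n$. Thus $X$ is the Hamiltonian vector field of $H$ for the Poisson bracket defined by $\{f,g\}\,\mathrm{d}x_1\wedge\dots\wedge \mathrm{d}x_n=\nu\,\mathrm{d}C_1\wedge\dots\wedge\mathrm{d}C_{n-2}\wedge\mathrm{d}f\wedge\mathrm{d}g$, whose Casimirs include $C_1,\dots,C_{n-2}$. For decomposable $k$-vectors define $\langle u_1\wedge\dots\wedge u_k,v_1\wedge\dots\wedge v_k\rangle_k:=\det[\langle u_i,v_j\rangle]_{1\le i,j\le k}$. The set of regular equilibria is $\mathcal{E}^{C_{n-1}}_{C_1,\dots,C_{n-2}}:=\{\overline{x}\in\Omega:\ \nu(\overline{x})\neq0,\ \nabla C_1(\overline{x})\wedge\dots\wedge\nabla C_{n-2}(\overline{x})\neq0,\ \nabla C_1(\overline{x})\wedge\dots\wedge\nabla C_{n-1}(\overline{x})=0\}$. For $\overline{x}_e$ in this set there is a unique $\overrightarrow{\lambda_e}=(\lambda^e_1,\dots,\lambda^e_{n-2})\in\mathbb{R}^{n-2}$ with $\nabla H(\overline{x}_e)+\sum_i\lambda^e_i\nabla C_i(\overline{x}_e)=0$; set $F_{\overrightarrow{\lambda_e}}:=H+\sum_{i=1}^{n-2}\lambda^e_iC_i$.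 $\overline{x}_e$ is called non-degenerate if $\det(\operatorname{Hess}F_{\overrightarrow{\lambda_e}}(\overline{x}_e))\neq0$, where $\operatorname{Hess}F(\overline{x})=\mathrm{D}(\nabla F)(\overline{x})$. For such $\overline{x}_e$, writing $A:=\operatorname{Hess}F_{\overrightarrow{\lambda_e}}(\overline{x}_e)$, $\mathcal{I}_X(\overline{x}_e):=\nu^2(\overline{x}_e)\det(A)\,\langle A^{-1}\nabla C_1(\overline{x}_e)\wedge\dots\wedge A^{-1}\nabla C_{n-2}(\overline{x}_e),\ \nabla C_1(\overline{x}_e)\wedge\dots\wedge\nabla C_{n-2}(\overline{x}_e)\rangle_{n-2}$. *)

theory Defs
  imports "HOL-Analysis.Analysis"
begin

text \<open>Coordinates of R^n are indexed by a finite well-ordered type 'n; the order of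
  'n fixes the numbering x_1,...,x_n. pos j (0-based) is the position of index j.\<close>

definition pos :: "'n::{finite,wellorder} \<Rightarrow> nat" where
  "pos j = card {k. k < j}"

definition partial :: "((real,'n::finite) vec \<Rightarrow> real) \<Rightarrow> 'n \<Rightarrow> (real,'n) vec \<Rightarrow> real" where
  "partial f l x = frechet_derivative f (at x) (axis l 1)"

definition grad :: "((real,'n::finite) vec \<Rightarrow> real) \<Rightarrow> (real,'n) vec \<Rightarrow> (real,'n) vec" where
  "grad f x = (\<chi> l. partial f l x)"

definition hess :: "((real,'n::finite) vec \<Rightarrow> real) \<Rightarrow> (real,'n) vec \<Rightarrow> ((real,'n) vec,'n) vec" where
  "hess f x = (\<chi> j l. partial (\<lambda>y. grad f y $ j) l x)"

fun Ck_on :: "nat \<Rightarrow> ((real,'n::finite) vec) set \<Rightarrow> ((real,'n) vec \<Rightarrow> real) \<Rightarrow> bool" where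
  "Ck_on 0 \<Omega> f = continuous_on \<Omega> f"
| "Ck_on (Suc k) \<Omega> f = (f differentiable_on \<Omega> \<and> (\<forall>l. Ck_on k \<Omega> (partial f l)))"

definition smooth_on :: "((real,'n::finite) vec) set \<Rightarrow> ((real,'n) vec \<Rightarrow> real) \<Rightarrow> bool" where
  "smooth_on \<Omega> f \<longleftrightarrow> (\<forall>k. Ck_on k \<Omega> f)"

text \<open>Jacobian determinant of (C_1,...,C_{n-2}, x_i, H) at x; C k for k = 1..n-2.\<close>

definition jac_det :: "(nat \<Rightarrow> (real,'n::{finite,wellorder}) vec \<Rightarrow> real) \<Rightarrow> ((real,'n) vec \<Rightarrow> real)
    \<Rightarrow> 'n \<Rightarrow> (real,'n) vec \<Rightarrow> real" where
  "jac_det C H i x = det (\<chi> j. if pos j < CARD('n) - 2 then grad (C (pos j + 1)) x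
                              else if pos j = CARD('n) - 2 then axis i 1
                              else grad H x)"

definition vfield :: "((real,'n::{finite,wellorder}) vec \<Rightarrow> real) \<Rightarrow> (nat \<Rightarrow> (real,'n) vec \<Rightarrow> real)
    \<Rightarrow> ((real,'n) vec \<Rightarrow> real) \<Rightarrow> (real,'n) vec \<Rightarrow> (real,'n) vec" where
  "vfield \<nu> C H x = (\<chi> i. \<nu> x * jac_det C H i x)"

text \<open>Wedge of vectors u 1,...,u m is nonzero iff they are linearly independent.\<close>

definition wedge_nonzero :: "nat \<Rightarrow> (nat \<Rightarrow> 'a::real_vector) \<Rightarrow> bool" where
  "wedge_nonzero m u \<longleftrightarrow> inj_on u {1..m} \<and> independent (u ` {1..m})"

text \<open>Inner product of decomposable m-vectors: det [<u_i, v_j>].\<close>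

definition wedge_inner :: "nat \<Rightarrow> (nat \<Rightarrow> 'a::real_inner) \<Rightarrow> (nat \<Rightarrow> 'a) \<Rightarrow> real" where
  "wedge_inner m u v =
     (\<Sum>p | p permutes {1..m}. of_int (sign p) * (\<Prod>i=1..m. inner (u i) (v (p i))))"

definition regular_equilibria :: "((real,'n::{finite,wellorder}) vec) set \<Rightarrow> ((real,'n) vec \<Rightarrow> real)
    \<Rightarrow> (nat \<Rightarrow> (real,'n) vec \<Rightarrow> real) \<Rightarrow> ((real,'n) vec \<Rightarrow> real) \<Rightarrow> ((real,'n) vec) set" where
  "regular_equilibria \<Omega> \<nu> C H = {x \<in> \<Omega>. \<nu> x \<noteq> 0
       \<and> wedge_nonzero (CARD('n) - 2) (\<lambda>k. grad (C k) x)
       \<and> \<not> wedge_nonzero (CARD('n) - 1) (\<lambda>k. grad (if k = CARD('n) - 1 then H else C k) x)}"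

definition is_solution :: "((real,'n::finite) vec \<Rightarrow> (real,'n) vec) \<Rightarrow> ((real,'n) vec) set \<Rightarrow> real set
    \<Rightarrow> (real \<Rightarrow> (real,'n) vec) \<Rightarrow> bool" where
  "is_solution X \<Omega> I x \<longleftrightarrow>
     (\<forall>t\<in>I. x t \<in> \<Omega> \<and> (x has_vector_derivative X (x t)) (at t within I))"

definition lyapunov_stable :: "((real,'n::finite) vec \<Rightarrow> (real,'n) vec) \<Rightarrow> ((real,'n) vec) set \<Rightarrow> (real,'n) vec \<Rightarrow> bool" where
  "lyapunov_stable X \<Omega> xe \<longleftrightarrow>
     (\<forall>\<epsilon>>0. \<exists>\<delta>>0. \<forall>x0. dist x0 xe < \<delta> \<longrightarrow>
        (\<exists>x. is_solution X \<Omega> {0..} x \<and> x 0 = x0) \<and>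
        (\<forall>x T. is_solution X \<Omega> {0..T} x \<and> x 0 = x0 \<longrightarrow> (\<forall>t\<in>{0..T}. dist (x t) xe < \<epsilon>)))"

definition unstable :: "((real,'n::finite) vec \<Rightarrow> (real,'n) vec) \<Rightarrow> ((real,'n) vec) set \<Rightarrow> (real,'n) vec \<Rightarrow> bool" where
  "unstable X \<Omega> xe \<longleftrightarrow> \<not> lyapunov_stable X \<Omega> xe"

text \<open>The quantity I_X(xe), given the Lagrange multipliers lam 1..lam (n-2).\<close>

definition F_lam :: "nat \<Rightarrow> (nat \<Rightarrow> real) \<Rightarrow> (nat \<Rightarrow> (real,'n::finite) vec \<Rightarrow> real) \<Rightarrow> ((real,'n) vec \<Rightarrow> real)
    \<Rightarrow> (real,'n) vec \<Rightarrow> real" where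
  "F_lam m lam C H = (\<lambda>x. H x + (\<Sum>k=1..m. lam k * C k x))"

definition index_IX :: "((real,'n::{finite,wellorder}) vec \<Rightarrow> real) \<Rightarrow> (nat \<Rightarrow> (real,'n) vec \<Rightarrow> real)
    \<Rightarrow> ((real,'n) vec \<Rightarrow> real) \<Rightarrow> (nat \<Rightarrow> real) \<Rightarrow> (real,'n) vec \<Rightarrow> real" where
  "index_IX \<nu> C H lam xe =
     (let m = CARD('n) - 2; A = hess (F_lam m lam C H) xe in
      (\<nu> xe)\<^sup>2 * det A * wedge_inner m (\<lambda>k. matrix_inv A *v grad (C k) xe) (\<lambda>k. grad (C k) xe))"

end

theory Submission
  imports Defs
begin

text \<open>The functions \<open>C\<^sub>k\<close> and \<open>F = H + \<Sum>\<lambda>\<^sub>k C\<^sub>k\<close> are first integrals of \<open>X\<close>, and \<open>F\<close> has a critical point at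
  the equilibrium, with Hessian \<open>A\<close>. Let \<open>e, f\<close> be an orthonormal basis of the plane \<open>T\<close> orthogonal to all
  \<open>\<nabla>C\<^sub>k\<close>. Multiplying the matrix with rows \<open>A\<inverse>\<nabla>C\<^sub>k, e, f\<close> once by \<open>A\<close> and once by the transpose of the matrix
  with rows \<open>\<nabla>C\<^sub>k, e, f\<close> shows that the index equals \<open>\<kappa>\<^sup>2 det (A|T)\<close> with
  \<open>\<kappa> = \<nu> det (\<nabla>C\<^sub>1, \<dots>, \<nabla>C\<^sub>n\<^sub>-\<^sub>2, e, f) \<noteq> 0\<close>.

  If the index is positive, \<open>A\<close> is definite on \<open>T\<close>, so by Taylor expansion the equilibrium is isolated in
  the common level set of \<open>F, C\<^sub>1, \<dots>, C\<^sub>n\<^sub>-\<^sub>2\<close>; the sum of the squared deviations of these first integrals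
  is a conserved function with a strict minimum there, which gives stability.

  If it is negative, the linearization of \<open>X\<close> is \<open>D h = \<kappa> (\<langle>A h, f\<rangle> e - \<langle>A h, e\<rangle> f)\<close>, which acts on \<open>T\<close> with
  the real eigenvalues \<open>\<plusminus>\<surd>(- index)\<close> and is zero on a complement of \<open>T\<close>. The quadratic form
  \<open>\<langle>D\<^sup>2 h, D h\<rangle> / \<kappa>\<^sup>2 - \<Sum>\<langle>\<nabla>C\<^sub>k, h\<rangle>\<^sup>2\<close> then satisfies the hypotheses of Chetaev's instability theorem.\<close>

section \<open>Ordinary differential equations\<close>

lemma integral_has_vector_derivative_atLeast:
  fixes g :: "real \<Rightarrow> 'a::euclidean_space"
  assumes g: "continuous_on {0..} g" and t: "0 \<le> t"
  shows "((\<lambda>u. integral {0..u} g) has_vector_derivative g t) (at t within {0..})"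
proof -
  have "((\<lambda>u. integral {0..u} g) has_vector_derivative g t) (at t within {0..t+1})"
    by (rule integral_has_vector_derivative) (use t in \<open>auto intro: continuous_on_subset[OF g]\<close>)
  moreover have "at t within {0..t+1} = at t within {0..}"
    by (rule at_within_nhd[of t "{t - 1<..<t + 1}"]) (use t in auto)
  ultimately show ?thesis by simp
qed

lemma integral_exp:
  fixes k :: real
  assumes "k \<noteq> 0" "0 \<le> t"
  shows "((\<lambda>s. exp (k * s)) has_integral (exp (k * t) - 1) / k) {0..t}"
proof -
  have "((\<lambda>s. exp (k * s)) has_integral exp (k * t) / k - exp (k * 0) / k) {0..t}"
  proof (rule fundamental_theorem_of_calculus[OF \<open>0 \<le> t\<close>])
    fix x
    have "((\<lambda>s. exp (k * s) / k) has_field_derivative exp (k * x)) (at x within {0..t})"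
      using assms by (auto intro!: derivative_eq_intros)
    then show "((\<lambda>s. exp (k * s) / k) has_vector_derivative exp (k * x)) (at x within {0..t})"
      by (simp add: has_real_derivative_iff_has_vector_derivative)
  qed
  then show ?thesis by (simp add: diff_divide_distrib)
qed

text \<open>Picard iteration in the norm weighted by \<open>exp (- k t)\<close> is a contraction on the whole
  half-line, so no continuation argument is needed.\<close>

lemma lipschitz_global_solution:
  fixes f :: "'a::euclidean_space \<Rightarrow> 'a"
  assumes lip: "L-lipschitz_on UNIV f" and bdd: "bounded (range f)"
  obtains x where "x 0 = x0"
    and "\<And>t. 0 \<le> t \<Longrightarrow> (x has_vector_derivative f (x t)) (at t within {0..})"
proof -
  have L0: "0 \<le> L" using lip by (rule lipschitz_on_nonneg)
  \<comment> \<open>The contraction factor will be \<open>L / k\<close>, so \<open>k\<close> at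
    least \<open>2 * L\<close> makes it at most 1/2; the summand 2 keeps \<open>k\<close> positive
    when \<open>L = 0\<close>.\<close>
  define k where "k = 2 * L + 2"
  have k: "0 < k" and Lk: "2 * L \<le> k" using L0 by (auto simp: k_def)
  obtain M where M: "\<And>x. norm (f x) \<le> M" using bdd by (auto simp: bounded_iff)
  have M0: "0 \<le> M" using M[of 0] norm_ge_zero order_trans by blast
  have fcont: "continuous_on UNIV f" using lip by (rule lipschitz_on_continuous_on)
  \<comment> \<open>The unknown is the rescaled curve \<open>y t = exp (- k t) x t\<close>, whose
    sup norm is the weighted norm of \<open>x\<close>.\<close>
  define g where "g y s = f (exp (k * s) *\<^sub>R y s)" for y :: "real \<Rightarrow> 'a" and s
  have gcont: "continuous_on S (g y)" if "continuous_on UNIV y" for y S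
    unfolding g_def
    by (intro continuous_intros continuous_on_compose2[OF fcont] continuous_on_subset[OF that]) auto
  have gint: "g y integrable_on {0..t}" if "continuous_on UNIV y" for y t
    by (rule integrable_continuous_real[OF gcont[OF that]])
  define P where "P y t = x0 + integral {0..t} (g y)" for y t
  \<comment> \<open>Freezing the time at 0 for negative \<open>t\<close> gives functions on the
    whole line, so that the complete space of bounded continuous functions can be used.\<close>
  define W where "W y t = exp (- (k * max 0 t)) *\<^sub>R P y (max 0 t)" for y t
  have Pder: "(P y has_vector_derivative g y t) (at t within {0..})"
    if "continuous_on UNIV y" "0 \<le> t" for y t
    unfolding P_def
    using integral_has_vector_derivative_atLeast[OF gcont[OF that(1)] that(2)]
    by (auto intro!: derivative_eq_intros)
  have Pcont: "continuous_on {0..} (P y)" if "continuous_on UNIV y" for y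
    by (rule continuous_on_vector_derivative) (use Pder[OF that] in auto)
  have Wbd: "W y \<in> bcontfun" if y: "continuous_on UNIV y" for y
  proof (rule bcontfun_normI)
    show "continuous_on UNIV (W y)" unfolding W_def
      by (intro continuous_intros continuous_on_compose2[OF Pcont[OF y]]) auto
    fix t :: real
    let ?u = "max 0 t"
    have "norm (integral {0..?u} (g y)) \<le> M * (?u - 0)"
      by (rule integral_bound[OF _ gcont[OF y]]) (auto simp: g_def M)
    then have "norm (P y ?u) \<le> norm x0 + M * ?u"
      unfolding P_def by (intro norm_triangle_le) simp
    moreover have "exp (- (k * ?u)) * (norm x0 + M * ?u) \<le> norm x0 + M / k"
    proof -
      have "k * ?u \<le> exp (k * ?u)" using exp_ge_add_one_self[of "k * ?u"] by linarith
      then have "?u \<le> exp (k * ?u) / k" unfolding pos_le_divide_eq[OF k] by (simp only: mult.commute)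
      then have "M * ?u \<le> M * (exp (k * ?u) / k)" using M0 by (rule mult_left_mono)
      then have "exp (- (k * ?u)) * (M * ?u) \<le> exp (- (k * ?u)) * (M * (exp (k * ?u) / k))"
        by (rule mult_left_mono) simp
      also have "\<dots> = M / k" by (simp add: exp_minus field_simps)
      finally have 1: "exp (- (k * ?u)) * (M * ?u) \<le> M / k" .
      have "exp (- (k * ?u)) * norm x0 \<le> 1 * norm x0"
        by (rule mult_right_mono) (use k in auto)
      with 1 show ?thesis by (simp add: algebra_simps)
    qed
    ultimately show "norm (W y t) \<le> norm x0 + M / k"
      unfolding W_def by (smt (verit) exp_gt_zero mult_left_mono norm_scaleR)
  qed
  define T where "T y = Bcontfun (W (apply_bcontfun y))" for y
  have T: "apply_bcontfun (T y) t = W (apply_bcontfun y) t" for y t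
    unfolding T_def by (subst Bcontfun_inverse) (auto simp: Wbd)
  have contr: "dist (T y) (T z) \<le> 1/2 * dist y z" for y z
  proof (rule dist_bound)
    fix t :: real
    let ?u = "max 0 t" and ?y = "apply_bcontfun y" and ?z = "apply_bcontfun z" and ?d = "dist y z"
    have iy: "g ?y integrable_on {0..?u}" "g ?z integrable_on {0..?u}" by (auto intro: gint)
    have ei: "((\<lambda>s. (L * ?d) * exp (k * s)) has_integral (L * ?d) * ((exp (k * ?u) - 1) / k)) {0..?u}"
      using integral_exp[of k ?u] k by (intro has_integral_mult_right) auto
    \<comment> \<open>The factor \<open>exp (k * s)\<close> integrates to at most
      \<open>exp (k * t) / k\<close>; the outer weight cancels the exponential and leaves the small
      factor \<open>L / k\<close>.\<close>
    have "norm (g ?y s - g ?z s) \<le> (L * ?d) * exp (k * s)" for s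
    proof -
      have "norm (g ?y s - g ?z s) \<le> L * norm (exp (k * s) *\<^sub>R ?y s - exp (k * s) *\<^sub>R ?z s)"
        unfolding g_def using lipschitz_onD[OF lip] by (simp add: dist_norm)
      also have "norm (exp (k * s) *\<^sub>R ?y s - exp (k * s) *\<^sub>R ?z s) = exp (k * s) * dist (?y s) (?z s)"
        by (simp add: dist_norm flip: scaleR_diff_right)
      also have "L * \<dots> \<le> L * (exp (k * s) * ?d)"
        by (intro mult_left_mono dist_bounded L0) auto
      finally show ?thesis by (simp add: mult_ac)
    qed
    then have "norm (integral {0..?u} (\<lambda>s. g ?y s - g ?z s)) \<le> integral {0..?u} (\<lambda>s. (L * ?d) * exp (k * s))"
      using ei by (intro integral_norm_bound_integral integrable_diff iy) auto
    also have "\<dots> = (L * ?d) * ((exp (k * ?u) - 1) / k)" using ei by (rule integral_unique)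
    also have "\<dots> \<le> (L * ?d) * (exp (k * ?u) / k)"
      using L0 k by (intro mult_left_mono divide_right_mono) auto
    also have "\<dots> = (L / k) * ?d * exp (k * ?u)" by simp
    also have "\<dots> \<le> (1/2) * ?d * exp (k * ?u)"
      using Lk k by (intro mult_right_mono) (auto simp: field_simps)
    finally have *: "norm (integral {0..?u} (\<lambda>s. g ?y s - g ?z s)) \<le> 1/2 * ?d * exp (k * ?u)" .
    have "dist (T y t) (T z t) = exp (- (k * ?u)) * norm (integral {0..?u} (\<lambda>s. g ?y s - g ?z s))"
      unfolding T W_def P_def dist_norm using integral_diff[OF iy]
      by (simp flip: scaleR_diff_right)
    also have "\<dots> \<le> exp (- (k * ?u)) * (1/2 * ?d * exp (k * ?u))"
      using * by (rule mult_left_mono) simp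
    also have "\<dots> = 1/2 * ?d" by (simp add: exp_minus field_simps)
    finally show "dist (T y t) (T z t) \<le> 1/2 * ?d" .
  qed
  obtain y where y: "T y = y"
    using banach_fix_type[of "1/2" T] contr by auto
  define x where "x = P y"
  have x_eq: "exp (k * t) *\<^sub>R y t = x t" if "0 \<le> t" for t
  proof -
    have "y t = exp (- (k * t)) *\<^sub>R x t"
      using T[of y t] that unfolding y W_def x_def by simp
    then show ?thesis by (simp add: exp_minus)
  qed
  show ?thesis
  proof (rule that)
    show "x 0 = x0" by (simp add: x_def P_def)
    fix t :: real assume "0 \<le> t"
    then show "(x has_vector_derivative f (x t)) (at t within {0..})"
      using Pder[of y t] x_eq[of t] unfolding x_def g_def by simp
  qed
qed

section \<open>Confinement by first integrals and Lyapunov stability\<close>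

text \<open>The exit time is the least element of the closed set where \<open>d\<close> has reached
  \<rho>; a value above \<rho> there would force an earlier crossing by the intermediate value
  theorem.\<close>

lemma first_exit:
  fixes d :: "real \<Rightarrow> real"
  assumes cont: "continuous_on {0..T} d" and d0: "d 0 < \<rho>" and t: "t \<in> {0..T}" "\<rho> \<le> d t"
  obtains s where "s \<in> {0<..T}" "d s = \<rho>" "\<And>u. u \<in> {0..<s} \<Longrightarrow> d u < \<rho>"
proof -
  define S where "S = {0..T} \<inter> d -` {\<rho>..}"
  have cl: "closed S" unfolding S_def
    by (subst Int_commute) (intro closed_vimage_Int cont; simp)
  have ne: "t \<in> S" using t by (auto simp: S_def)
  have bb: "bdd_below S" by (rule bdd_belowI[of _ 0]) (auto simp: S_def)
  define s where "s = Inf S"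
  have sS: "s \<in> S" unfolding s_def using ne by (intro closed_contains_Inf bb cl) auto
  have lt: "d u < \<rho>" if "u \<in> {0..<s}" for u
  proof (rule ccontr)
    assume "\<not> d u < \<rho>"
    then have "u \<in> S" using that sS by (auto simp: S_def)
    then have "s \<le> u" unfolding s_def by (rule cInf_lower[OF _ bb])
    then show False using that by simp
  qed
  have s0: "0 < s" using sS d0 by (cases "s = 0") (auto simp: S_def)
  have "d s \<le> \<rho>"
  proof (rule ccontr)
    assume "\<not> d s \<le> \<rho>"
    moreover have "continuous_on {0..s} d" by (rule continuous_on_subset[OF cont]) (use sS in \<open>auto simp: S_def\<close>)
    ultimately obtain u where "0 \<le> u" "u \<le> s" "d u = \<rho>"
      using IVT'[of d 0 \<rho> s] d0 s0 by auto
    then show False using lt[of u] \<open>\<not> d s \<le> \<rho>\<close> by (cases "u = s") auto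
  qed
  then show ?thesis using that[of s] sS s0 lt by (auto simp: S_def)
qed

lemma is_solution_subset:
  "is_solution X \<Omega> I x \<Longrightarrow> J \<subseteq> I \<Longrightarrow> is_solution X \<Omega> J x"
  unfolding is_solution_def by (meson has_vector_derivative_within_subset subsetD)

lemma is_solution_continuous_on:
  "is_solution X \<Omega> I x \<Longrightarrow> continuous_on I x"
  unfolding is_solution_def by (rule continuous_on_vector_derivative) auto

lemma has_real_derivative_along_curve:
  fixes V :: "(real,'n::finite) vec \<Rightarrow> real"
  assumes "(V has_derivative V') (at (x t))" "(x has_vector_derivative v) (at t within I)"
  shows "((\<lambda>t. V (x t)) has_real_derivative V' v) (at t within I)"
proof -
  have "((\<lambda>t. V (x t)) has_derivative (\<lambda>h. V' (h *\<^sub>R v))) (at t within I)"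
    by (rule has_derivative_compose[OF assms(2)[unfolded has_vector_derivative_def] assms(1)])
  moreover have "(\<lambda>h. V' (h *\<^sub>R v)) = (*) (V' v)"
    using assms(1) by (auto simp: linear_scale[OF has_derivative_linear])
  ultimately show ?thesis by (simp add: has_field_derivative_def)
qed

text \<open>Up to the first time on the sphere \<open>V\<close> is constant along the solution, but
  on the sphere it would have to exceed its initial value. The field \<open>Y\<close> and the domain
  are arbitrary because the lemma is applied both to \<open>X\<close> and to a global extension of
  it.\<close>

lemma first_integral_confines:
  fixes V :: "(real,'n::finite) vec \<Rightarrow> real"
  assumes x: "is_solution Y \<Omega> {0..T} x"
    and V: "\<And>y. y \<in> cball xe \<rho> \<Longrightarrow> (V has_derivative V' y) (at y)"
    and inv: "\<And>y. y \<in> cball xe \<rho> \<Longrightarrow> V' y (Y y) = 0"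
    and sph: "\<And>y. dist y xe = \<rho> \<Longrightarrow> V (x 0) < V y"
    and x0: "dist (x 0) xe < \<rho>" and t: "t \<in> {0..T}"
  shows "dist (x t) xe < \<rho>"
proof (rule ccontr)
  assume "\<not> ?thesis"
  then have "\<rho> \<le> dist (x t) xe" by simp
  moreover have "continuous_on {0..T} (\<lambda>t. dist (x t) xe)"
    using is_solution_continuous_on[OF x] by (intro continuous_intros)
  ultimately obtain s where s: "s \<in> {0<..T}" "dist (x s) xe = \<rho>"
    and lt: "\<And>u. u \<in> {0..<s} \<Longrightarrow> dist (x u) xe < \<rho>"
    using first_exit[of T "\<lambda>t. dist (x t) xe" \<rho> t] x0 t by auto
  have xs: "is_solution Y \<Omega> {0..s} x" by (rule is_solution_subset[OF x]) (use s in auto)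
  have "((\<lambda>t. V (x t)) has_real_derivative 0) (at u within {0..s})" if u: "u \<in> {0..s}" for u
  proof -
    have *: "x u \<in> cball xe \<rho>" using lt[of u] u s by (cases "u = s") (auto simp: dist_commute)
    show ?thesis
      using has_real_derivative_along_curve[of V "V' (x u)" x u "Y (x u)" "{0..s}"] V[OF *] xs u inv[OF *]
      unfolding is_solution_def by auto
  qed
  then obtain c where "\<And>u. u \<in> {0..s} \<Longrightarrow> V (x u) = c"
    using has_field_derivative_zero_constant[of "{0..s}" "\<lambda>t. V (x t)"] by auto
  then have "V (x 0) = V (x s)" using s by auto
  then show False using sph[OF s(2)] by simp
qed

text \<open>Stability as defined includes existence for all positive times. Solutions are therefore
  taken from a globally Lipschitz extension of \<open>X\<close>; confinement keeps them in the ball,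
  where the extension agrees with \<open>X\<close>.\<close>

theorem lyapunov_stable_first_integral:
  fixes V :: "(real,'n::finite) vec \<Rightarrow> real"
  assumes r: "0 < r" and sub: "cball xe r \<subseteq> \<Omega>" and lip: "L-lipschitz_on (cball xe r) X"
    and V: "\<And>y. y \<in> cball xe r \<Longrightarrow> (V has_derivative V' y) (at y)"
    and inv: "\<And>y. y \<in> cball xe r \<Longrightarrow> V' y (X y) = 0"
    and min: "\<And>y. y \<in> cball xe r \<Longrightarrow> y \<noteq> xe \<Longrightarrow> V xe < V y"
  shows "lyapunov_stable X \<Omega> xe"
  unfolding lyapunov_stable_def
proof (intro allI impI)
  fix \<epsilon> :: real assume \<epsilon>: "0 < \<epsilon>"
  define \<rho> where "\<rho> = min \<epsilon> r"
  have \<rho>: "0 < \<rho>" "\<rho> \<le> \<epsilon>" "\<rho> \<le> r" using \<epsilon> r by (auto simp: \<rho>_def)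
  have subr: "cball xe \<rho> \<subseteq> cball xe r" using \<rho> by auto
  have Vcont: "continuous_on (cball xe r) V"
    using V by (meson continuous_at_imp_continuous_on has_derivative_continuous)
  have "sphere xe \<rho> \<noteq> {}" using \<rho> by simp
  \<comment> \<open>\<open>V w\<close> is the height of the barrier on the sphere; starting points
    with \<open>V\<close> below it cannot cross.\<close>
  then obtain w where w: "w \<in> sphere xe \<rho>" and wmin: "\<And>y. y \<in> sphere xe \<rho> \<Longrightarrow> V w \<le> V y"
    using continuous_attains_inf[of "sphere xe \<rho>" V] continuous_on_subset[OF Vcont]
      subr by (metis compact_sphere sphere_cball subset_trans)
  have "w \<noteq> xe" "w \<in> cball xe r" using w \<rho> by auto
  then have Vw: "V xe < V w" using min by blast
  have "isCont V xe" using V[of xe] r by (auto intro: has_derivative_continuous)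
  then have "\<forall>\<^sub>F y in at xe. V y < V w" using Vw by (auto simp: isCont_def intro: order_tendstoD)
  then obtain d where d: "0 < d" "\<And>y. dist y xe < d \<Longrightarrow> V y < V w"
    using Vw unfolding eventually_at by (metis UNIV_I)
  define \<delta> where "\<delta> = min d \<rho>"
  have "0 < \<delta>" using d \<rho> by (auto simp: \<delta>_def)
  moreover have "(\<exists>x. is_solution X \<Omega> {0..} x \<and> x 0 = x0) \<and>
        (\<forall>x T. is_solution X \<Omega> {0..T} x \<and> x 0 = x0 \<longrightarrow> (\<forall>t\<in>{0..T}. dist (x t) xe < \<epsilon>))"
    if x0: "dist x0 xe < \<delta>" for x0
  proof
    have sph: "V x0 < V y" if "dist y xe = \<rho>" for y
    proof -
      have "V x0 < V w" using d x0 by (auto simp: \<delta>_def)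
      also have "V w \<le> V y" using that by (intro wmin) (auto simp: dist_commute)
      finally show ?thesis .
    qed
    have conf: "dist (x t) xe < \<rho>"
      if "is_solution Y U {0..T} x" "\<And>y. y \<in> cball xe r \<Longrightarrow> Y y = X y" "x 0 = x0" "t \<in> {0..T}"
      for Y U T x t
      by (rule first_integral_confines[OF that(1), of xe \<rho> V V'])
        (use that subr sph x0 V inv \<rho> in \<open>auto simp: \<delta>_def dist_commute subset_iff\<close>)
    show "\<forall>x T. is_solution X \<Omega> {0..T} x \<and> x 0 = x0 \<longrightarrow> (\<forall>t\<in>{0..T}. dist (x t) xe < \<epsilon>)"
      using conf[of X] \<rho> by fastforce
    let ?B = "cball xe r"
    \<comment> \<open>The projection onto the ball is nonexpansive, so the Lipschitz constant
      survives, and the range lies in the bounded image of the compact ball.\<close>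
    define Y where "Y = X \<circ> closest_point ?B"
    have cp: "closest_point ?B y \<in> ?B" for y using r by (intro closest_point_in_set) auto
    have YX: "Y y = X y" if "y \<in> ?B" for y using that by (simp add: Y_def closest_point_self)
    have L0: "0 \<le> L" using lip by (rule lipschitz_on_nonneg)
    have "L-lipschitz_on UNIV Y"
    proof (rule lipschitz_onI[OF _ L0])
      fix a b
      have "dist (Y a) (Y b) \<le> L * dist (closest_point ?B a) (closest_point ?B b)"
        unfolding Y_def o_def by (rule lipschitz_onD[OF lip cp cp])
      also have "\<dots> \<le> L * dist a b"
        using r by (intro mult_left_mono L0 closest_point_lipschitz) auto
      finally show "dist (Y a) (Y b) \<le> L * dist a b" .
    qed
    moreover have "bounded (range Y)"
    proof (rule bounded_subset)
      show "bounded (X ` ?B)"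
        by (intro compact_imp_bounded compact_continuous_image lipschitz_on_continuous_on[OF lip]) auto
      show "range Y \<subseteq> X ` ?B" using cp by (auto simp: Y_def)
    qed
    ultimately obtain x where x: "x 0 = x0"
      "\<And>t. 0 \<le> t \<Longrightarrow> (x has_vector_derivative Y (x t)) (at t within {0..})"
      using lipschitz_global_solution by blast
    have sol: "is_solution Y UNIV {0..} x" using x by (auto simp: is_solution_def)
    have xB: "x t \<in> ?B" if "0 \<le> t" for t
    proof -
      have "is_solution Y UNIV {0..t} x" by (rule is_solution_subset[OF sol]) auto
      then have "dist (x t) xe < \<rho>" using conf[of Y UNIV t x t] YX x that by auto
      then show ?thesis using \<rho> by (auto simp: dist_commute)
    qed
    have "is_solution X \<Omega> {0..} x"
      unfolding is_solution_def using x xB YX sub by (metis atLeast_iff subsetD)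
    then show "\<exists>x. is_solution X \<Omega> {0..} x \<and> x 0 = x0" using x by blast
  qed
  ultimately show "\<exists>\<delta>>0. \<forall>x0. dist x0 xe < \<delta> \<longrightarrow>
        (\<exists>x. is_solution X \<Omega> {0..} x \<and> x 0 = x0) \<and>
        (\<forall>x T. is_solution X \<Omega> {0..T} x \<and> x 0 = x0 \<longrightarrow> (\<forall>t\<in>{0..T}. dist (x t) xe < \<epsilon>))" by blast
qed

section \<open>Chetaev's instability theorem\<close>

text \<open>Stability would give a solution that starts with \<open>V\<close> positive and stays in
  the ball forever. There \<open>V\<close> grows at least like \<open>exp (c * t)\<close>, which
  contradicts the bound \<open>M\<close>. Growth is assumed only where \<open>V\<close> is positive,
  so positivity has to be propagated in time.\<close>

theorem chetaev_unstable:
  fixes V :: "(real,'n::finite) vec \<Rightarrow> real"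
  assumes r: "0 < r" and c: "0 < c"
    and V: "\<And>y. y \<in> ball xe r \<Longrightarrow> (V has_derivative V' y) (at y)"
    and grow: "\<And>y. y \<in> ball xe r \<Longrightarrow> 0 < V y \<Longrightarrow> c * V y \<le> V' y (X y)"
    and bdd: "\<And>y. y \<in> ball xe r \<Longrightarrow> V y \<le> M"
    and pos: "\<And>\<delta>. 0 < \<delta> \<Longrightarrow> \<exists>y. dist y xe < \<delta> \<and> 0 < V y"
  shows "unstable X \<Omega> xe"
  unfolding unstable_def
proof
  assume "lyapunov_stable X \<Omega> xe"
  with r obtain \<delta> where \<delta>: "0 < \<delta>" and
    st: "\<And>x0. dist x0 xe < \<delta> \<Longrightarrow> (\<exists>x. is_solution X \<Omega> {0..} x \<and> x 0 = x0) \<and>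
        (\<forall>x T. is_solution X \<Omega> {0..T} x \<and> x 0 = x0 \<longrightarrow> (\<forall>t\<in>{0..T}. dist (x t) xe < r))"
    unfolding lyapunov_stable_def by blast
  obtain x0 where x0: "dist x0 xe < \<delta>" "0 < V x0" using pos[OF \<delta>] by blast
  obtain x where x: "is_solution X \<Omega> {0..} x" "x 0 = x0" using st[OF x0(1)] by blast
  have xB: "x t \<in> ball xe r" if "0 \<le> t" for t
  proof -
    have "is_solution X \<Omega> {0..t} x" by (rule is_solution_subset[OF x(1)]) auto
    then have "dist (x t) xe < r" using st[OF x0(1)] x(2) that by auto
    then show ?thesis by (simp add: dist_commute)
  qed
  \<comment> \<open>With this integrating factor the growth condition says that
    \<open>\<phi>\<close> does not decrease while it is positive.\<close>
  define \<phi> where "\<phi> t = exp (- c * t) * V (x t)" for t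
  have der: "(\<phi> has_real_derivative exp (- c * t) * (V' (x t) (X (x t)) - c * V (x t))) (at t within {0..})"
    if t: "0 \<le> t" for t
  proof -
    have "((\<lambda>t. V (x t)) has_real_derivative V' (x t) (X (x t))) (at t within {0..})"
      by (rule has_real_derivative_along_curve) (use V[OF xB[OF t]] x t in \<open>auto simp: is_solution_def\<close>)
    then show ?thesis unfolding \<phi>_def
      by (auto intro!: derivative_eq_intros simp: algebra_simps)
  qed
  have ders: "(\<phi> has_real_derivative exp (- c * t) * (V' (x t) (X (x t)) - c * V (x t))) (at t within {0..s})"
    if "0 \<le> t" for t s
    by (rule has_field_derivative_subset[OF der[OF that]]) auto
  have \<phi>cont: "continuous_on {0..s} \<phi>" for s
    by (rule DERIV_continuous_on) (use ders in auto)
  have mono: "\<phi> 0 \<le> \<phi> s" if s: "0 \<le> s" and nn: "\<And>u. u \<in> {0..<s} \<Longrightarrow> 0 < \<phi> u" for s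
  proof (rule DERIV_nonneg_imp_increasing_open[OF s])
    show "continuous_on {0..s} \<phi>" by (rule \<phi>cont)
    fix u assume u: "0 < u" "u < s"
    then have "0 < V (x u)" using nn[of u] by (auto simp: \<phi>_def zero_less_mult_iff)
    then have "0 \<le> exp (- c * u) * (V' (x u) (X (x u)) - c * V (x u))"
      using grow[OF xB[of u]] u by auto
    moreover have "(\<phi> has_real_derivative exp (- c * u) * (V' (x u) (X (x u)) - c * V (x u))) (at u)"
      using der[of u] u at_within_interior[of u "{0..}"] by (simp add: interior_real_atLeast)
    ultimately show "\<exists>y. (\<phi> has_real_derivative y) (at u) \<and> 0 \<le> y" by blast
  qed
  have \<phi>0: "\<phi> 0 = V x0" using x by (simp add: \<phi>_def)
  \<comment> \<open>At the first zero of \<open>\<phi>\<close> monotonicity on the preceding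
    interval would give a value of at least \<open>\<phi> 0 > 0\<close>.\<close>
  have \<phi>pos: "0 < \<phi> t" if "0 \<le> t" for t
  proof (rule ccontr)
    assume "\<not> 0 < \<phi> t"
    then have "- \<phi> 0 < 0" "t \<in> {0..t}" "0 \<le> - \<phi> t" using \<phi>0 x0 that by auto
    from first_exit[OF continuous_on_minus[OF \<phi>cont] this]
    obtain s where "s \<in> {0<..t}" "- \<phi> s = 0" "\<And>u. u \<in> {0..<s} \<Longrightarrow> - \<phi> u < 0"
      by blast
    then show False using mono[of s] \<phi>0 x0 by auto
  qed
  have bound: "V x0 * exp (c * t) \<le> M" if "0 \<le> t" for t
  proof -
    have "V x0 \<le> \<phi> t" using mono[OF that] \<phi>pos \<phi>0 by auto
    then have "V x0 * exp (c * t) \<le> \<phi> t * exp (c * t)" by (rule mult_right_mono) simp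
    also have "\<dots> = V (x t)" by (simp add: \<phi>_def exp_minus)
    also have "\<dots> \<le> M" by (rule bdd[OF xB[OF that]])
    finally show ?thesis .
  qed
  \<comment> \<open>At this time the linear lower bound \<open>V x0 * (1 + c * t)\<close> already
    equals \<open>V x0 + M\<close>.\<close>
  define t where "t = M / (V x0 * c)"
  have "0 \<le> M" using bound[of 0] x0 by simp
  then have t0: "0 \<le> t" using x0 c by (simp add: t_def)
  have "V x0 * (1 + c * t) \<le> V x0 * exp (c * t)"
    using x0 exp_ge_add_one_self by (intro mult_left_mono) auto
  moreover have "V x0 * (1 + c * t) = V x0 + M" using x0 c by (simp add: t_def field_simps)
  ultimately show False using bound[OF t0] x0 by linarith
qed

section \<open>Determinants\<close>

lemma pos_strict_mono: "j < k \<Longrightarrow> pos j < pos k"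
  unfolding pos_def by (rule psubset_card_mono) auto

lemma inj_pos: "inj pos"
  by (rule strict_mono_imp_inj_on) (simp add: strict_mono_def pos_strict_mono)

lemma range_pos: "range (pos :: 'n::{finite,wellorder} \<Rightarrow> nat) = {..<CARD('n)}"
proof -
  have "pos j < CARD('n)" for j :: 'n
    unfolding pos_def by (rule psubset_card_mono) auto
  then have "range (pos :: 'n \<Rightarrow> nat) \<subseteq> {..<CARD('n)}" by auto
  moreover have "card (range (pos :: 'n \<Rightarrow> nat)) = CARD('n)" by (rule card_image[OF inj_pos])
  ultimately show ?thesis by (intro card_subset_eq) auto
qed

text \<open>With the last two rows kept free, the Jacobian determinant, the vector field and the
  index all become values of one alternating bilinear form in \<open>w\<close> and \<open>z\<close>.
  The shift \<open>pos j + 1\<close> turns positions counted from 0 into the labels 1, ...,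
  n-2.\<close>

definition frame :: "(nat \<Rightarrow> (real,'n::{finite,wellorder}) vec) \<Rightarrow> (real,'n) vec \<Rightarrow> (real,'n) vec
    \<Rightarrow> ((real,'n) vec,'n) vec" where
  "frame c w z = (\<chi> j. if pos j < CARD('n) - 2 then c (pos j + 1)
                      else if pos j = CARD('n) - 2 then w else z)"

lemma jac_det_frame: "jac_det C H i x = det (frame (\<lambda>k. grad (C k) x) (axis i 1) (grad H x))"
  by (simp add: jac_det_def frame_def)

text \<open>Row operations on \<open>det\<close> require the actual row indices of \<open>w\<close>
  and \<open>z\<close>. For n = 1 truncated subtraction makes both positions 0; requiring
  distinctness rules that case out.\<close>

definition last_two :: "'n::{finite,wellorder} \<Rightarrow> 'n \<Rightarrow> bool" where
  "last_two p q \<longleftrightarrow> pos p = CARD('n) - 2 \<and> pos q = CARD('n) - 1 \<and> p \<noteq> q"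

lemma last_two_exists:
  assumes "CARD('n::{finite,wellorder}) \<ge> 2"
  obtains p q :: "'n::{finite,wellorder}" where "last_two p q"
proof -
  note ran = range_pos[where 'n = 'n]
  have "CARD('n) - 2 \<in> range (pos :: 'n \<Rightarrow> nat)" "CARD('n) - 1 \<in> range (pos :: 'n \<Rightarrow> nat)"
    unfolding ran using assms by auto
  then obtain p q :: 'n where pq: "pos p = CARD('n) - 2" "pos q = CARD('n) - 1" by (metis imageE)
  then have "p \<noteq> q" using assms by auto
  then show ?thesis using that[of p q] pq by (simp add: last_two_def)
qed

lemma last_twoD:
  fixes p q :: "'n::{finite,wellorder}"
  assumes pq: "last_two p q"
  shows "p \<noteq> q" "pos j < CARD('n) - 2 \<longleftrightarrow> j \<noteq> p \<and> j \<noteq> q" "pos j = CARD('n) - 2 \<longleftrightarrow> j = p"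
    and "k \<in> {1..CARD('n) - 2} \<Longrightarrow> \<exists>j. j \<noteq> p \<and> j \<noteq> q \<and> pos j + 1 = k"
proof -
  note ran = range_pos[where 'n = 'n]
  have lt: "pos j < CARD('n)" for j :: 'n using ran by auto
  show ne: "p \<noteq> q" using pq by (simp add: last_two_def)
  show p_iff: "pos j = CARD('n) - 2 \<longleftrightarrow> j = p" for j
    using pq injD[OF inj_pos, of j p] by (auto simp: last_two_def)
  have q_iff: "pos j = CARD('n) - 1 \<longleftrightarrow> j = q" for j
    using pq injD[OF inj_pos, of j q] by (auto simp: last_two_def)
  show less: "pos j < CARD('n) - 2 \<longleftrightarrow> j \<noteq> p \<and> j \<noteq> q" for j
    using p_iff[of j] q_iff[of j] p_iff[of q] q_iff[of q] ne lt[of j] by linarith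
  assume k: "k \<in> {1..CARD('n) - 2}"
  have "k - 1 \<in> range (pos :: 'n \<Rightarrow> nat)" unfolding ran using k by auto
  then obtain j :: 'n where "pos j = k - 1" by (metis imageE)
  then show "\<exists>j. j \<noteq> p \<and> j \<noteq> q \<and> pos j + 1 = k" using less[of j] k by (intro exI[of _ j]) auto
qed

context
  assumes n2: "CARD('n::{finite,wellorder}) \<ge> 2"
begin

lemma linear_det_frame1: "linear (\<lambda>w. det (frame c w (z :: (real,'n) vec)))"
proof -
  obtain p q :: 'n where "last_two p q" using last_two_exists[OF n2] .
  note pq = last_twoD[OF this]
  have eq: "frame c w z = (\<chi> j. if j = p then w else if j = q then z else c (pos j + 1))" for w
    using pq by (simp add: frame_def vec_eq_iff)
  show ?thesis
  proof (rule linearI)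
    show "det (frame c (x + y) z) = det (frame c x z) + det (frame c y z)" for x y
      unfolding eq using det_row_add[of p "\<lambda>_. x" "\<lambda>_. y"] by simp
    show "det (frame c (r *\<^sub>R x) z) = r *\<^sub>R det (frame c x z)" for r x
      using det_row_mul[of p r "\<lambda>_. x" "\<lambda>j. if j = q then z else c (pos j + 1)"]
      unfolding eq scalar_mult_eq_scaleR by simp
  qed
qed

lemma linear_det_frame2: "linear (\<lambda>z. det (frame c (w :: (real,'n) vec) z))"
proof -
  obtain p q :: 'n where "last_two p q" using last_two_exists[OF n2] .
  note pq = last_twoD[OF this]
  have eq: "frame c w z = (\<chi> j. if j = q then z else if j = p then w else c (pos j + 1))" for z
    using pq by (simp add: frame_def vec_eq_iff)
  show ?thesis
  proof (rule linearI)
    show "det (frame c w (x + y)) = det (frame c w x) + det (frame c w y)" for x y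
      unfolding eq using det_row_add[of q "\<lambda>_. x" "\<lambda>_. y"] by simp
    show "det (frame c w (r *\<^sub>R x)) = r *\<^sub>R det (frame c w x)" for r x
      using det_row_mul[of q r "\<lambda>_. x" "\<lambda>j. if j = p then w else c (pos j + 1)"]
      unfolding eq scalar_mult_eq_scaleR by simp
  qed
qed

lemma det_frame_same: "det (frame c w (w :: (real,'n) vec)) = 0"
proof -
  obtain p q :: 'n where "last_two p q" using last_two_exists[OF n2] .
  note pq = last_twoD[OF this]
  show ?thesis
    by (rule det_identical_rows[OF pq(1)]) (use pq in \<open>auto simp: row_def frame_def vec_eq_iff\<close>)
qed

text \<open>By linearity it suffices to insert a generator \<open>c k\<close>, which repeats a row.
  This is the reason why the \<open>C k\<close> are Casimirs.\<close>

lemma det_frame_span1: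
  assumes "w \<in> span (c ` {1..CARD('n) - 2})"
  shows "det (frame c w (z :: (real,'n) vec)) = 0"
proof (rule linear_eq_0_on_span[OF linear_det_frame1 _ assms])
  obtain p q :: 'n where "last_two p q" using last_two_exists[OF n2] .
  note pq = last_twoD[OF this]
  fix x assume "x \<in> c ` {1..CARD('n) - 2}"
  then obtain j where j: "j \<noteq> p" "j \<noteq> q" "x = c (pos j + 1)" using pq(4) by force
  then show "det (frame c x z) = 0"
    by (intro det_identical_rows[OF j(1)]) (use pq in \<open>auto simp: row_def frame_def vec_eq_iff\<close>)
qed

text \<open>The counterpart for the last row; it allows the gradient of \<open>H\<close> to be
  replaced by that of \<open>F_lam\<close>.\<close>

lemma det_frame_span2:
  assumes "z \<in> span (c ` {1..CARD('n) - 2})"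
  shows "det (frame c (w :: (real,'n) vec) z) = 0"
proof (rule linear_eq_0_on_span[OF linear_det_frame2 _ assms])
  obtain p q :: 'n where "last_two p q" using last_two_exists[OF n2] .
  note pq = last_twoD[OF this]
  fix x assume "x \<in> c ` {1..CARD('n) - 2}"
  then obtain j where j: "j \<noteq> p" "j \<noteq> q" "x = c (pos j + 1)" using pq(4) by force
  then show "det (frame c w x) = 0"
    by (intro det_identical_rows[OF j(2)]) (use pq in \<open>auto simp: row_def frame_def vec_eq_iff\<close>)
qed

text \<open>Polarization: the form vanishes when both free rows are \<open>w + z\<close>.\<close>

lemma det_frame_commute: "det (frame c w (z :: (real,'n) vec)) = - det (frame c z w)"
proof -
  have "0 = det (frame c (w + z) (w + z))" by (simp add: det_frame_same)
  also have "\<dots> = det (frame c w z) + det (frame c z w)"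
    unfolding linear_add[OF linear_det_frame1] linear_add[OF linear_det_frame2]
    by (simp add: det_frame_same)
  finally show ?thesis by linarith
qed

end

section \<open>The plane orthogonal to the gradients\<close>

text \<open>The last clause expresses the decomposition of the space into the plane and the span of
  the \<open>c k\<close>: removing the components along \<open>e\<close> and \<open>f\<close> leaves
  a vector of the span. For n = 2 the span is zero and \<open>e\<close>, \<open>f\<close> form a
  basis of the whole space.\<close>

definition complement_basis :: "(nat \<Rightarrow> (real,'n::finite) vec) \<Rightarrow> (real,'n) vec \<Rightarrow> (real,'n) vec \<Rightarrow> bool" where
  "complement_basis c e f \<longleftrightarrow> inner e e = 1 \<and> inner f f = 1 \<and> inner e f = 0 \<and>
     (\<forall>k\<in>{1..CARD('n) - 2}. inner (c k) e = 0 \<and> inner (c k) f = 0) \<and>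
     (\<forall>x. x - inner x e *\<^sub>R e - inner x f *\<^sub>R f \<in> span (c ` {1..CARD('n) - 2}))"

text \<open>The span of n-2 independent vectors has a complement of dimension 2; any orthonormal
  basis of it will do.\<close>

lemma complement_basis_exists:
  fixes c :: "nat \<Rightarrow> (real,'n::finite) vec"
  assumes n2: "CARD('n) \<ge> 2" and c: "wedge_nonzero (CARD('n) - 2) c"
  obtains e f where "complement_basis c e f"
proof -
  let ?m = "CARD('n) - 2"
  let ?S = "span (c ` {1..?m})"
  define T where "T = {y. \<forall>x\<in>?S. orthogonal x y}"
  have "dim ?S = ?m"
    using c unfolding wedge_nonzero_def by (simp add: dim_eq_card_independent card_image)
  moreover have "dim T + dim ?S = CARD('n)"
    using dim_subspace_orthogonal_to_vectors[of ?S UNIV] by (simp add: T_def)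
  ultimately have dT: "dim T = 2" using n2 by simp
  have "subspace T"
    unfolding T_def subspace_def orthogonal_def by (auto simp: inner_right_distrib)
  then obtain B where B: "B \<subseteq> T" "pairwise orthogonal B" "\<And>x. x \<in> B \<Longrightarrow> norm x = 1"
      "card B = dim T" "span B = T"
    using orthonormal_basis_subspace by metis
  obtain e f where ef: "B = {e, f}" "e \<noteq> f" using B(4) dT by (metis card_2_iff)
  have on: "inner e e = 1" "inner f f = 1" "inner e f = 0"
    using B(2,3) ef by (auto simp: norm_eq_1 pairwise_def orthogonal_def)
  have ck: "inner (c k) e = 0 \<and> inner (c k) f = 0" if "k \<in> {1..?m}" for k
    using B(1) that ef by (auto simp: T_def orthogonal_def span_base)
  have "x - inner x e *\<^sub>R e - inner x f *\<^sub>R f \<in> ?S" for x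
  proof -
    obtain y z where yz: "y \<in> ?S" "\<And>w. w \<in> ?S \<Longrightarrow> orthogonal z w" "x = y + z"
      using orthogonal_subspace_decomp_exists[of "c ` {1..?m}" x] by blast
    have "z \<in> span {e, f}" using yz B(5) ef by (auto simp: T_def orthogonal_commute)
    then obtain \<alpha> \<beta> where z: "z = \<alpha> *\<^sub>R e + \<beta> *\<^sub>R f"
      by (auto simp: span_insert algebra_simps)
    have "inner y e = 0" "inner y f = 0" using yz(1) B(1) ef by (auto simp: T_def orthogonal_def)
    then have "inner x e = \<alpha>" "inner x f = \<beta>"
      using on by (simp_all add: yz z inner_add_left inner_commute[of f e])
    then show ?thesis using yz(1) by (simp add: yz(3) z)
  qed
  then show ?thesis using that on ck unfolding complement_basis_def by blast
qed

text \<open>Such a vector lies in the span of the \<open>c k\<close> and is orthogonal to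
  it.\<close>

lemma complement_basis_eq_0:
  assumes "complement_basis c e f" "inner x e = 0" "inner x f = 0"
    and "\<And>k. k \<in> {1..CARD('n) - 2} \<Longrightarrow> inner (c k) (x :: (real,'n::finite) vec) = 0"
  shows "x = 0"
proof -
  have "x \<in> span (c ` {1..CARD('n) - 2})"
    using assms(1-3) unfolding complement_basis_def by (metis diff_zero scale_zero_left)
  then have "orthogonal x x"
    by (rule orthogonal_to_span) (use assms(4) in \<open>auto simp: orthogonal_def inner_commute\<close>)
  then show ?thesis by (simp add: orthogonal_self)
qed

text \<open>The form ignores the span of the \<open>c k\<close>, so it depends only on the
  \<open>e\<close> and \<open>f\<close> coordinates of its arguments, and an alternating form on a
  plane is a multiple of the 2 by 2 determinant.\<close>

lemma det_frame_complement_basis: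
  fixes w z :: "(real,'n::{finite,wellorder}) vec"
  assumes n2: "CARD('n) \<ge> 2" and b: "complement_basis c e f"
  shows "det (frame c w z) = det (frame c e f) * (inner w e * inner z f - inner w f * inner z e)"
proof -
  note l1 = linear_det_frame1[OF n2] and l2 = linear_det_frame2[OF n2]
  have 1: "det (frame c w z) = inner w e * det (frame c e z) + inner w f * det (frame c f z)" for w z
  proof -
    have "det (frame c (w - inner w e *\<^sub>R e - inner w f *\<^sub>R f) z) = 0"
      by (rule det_frame_span1[OF n2]) (use b in \<open>auto simp: complement_basis_def\<close>)
    then show ?thesis by (simp add: linear_diff[OF l1] linear_scale[OF l1])
  qed
  have "det (frame c e z) = inner z f * det (frame c e f)"
    using 1[of z e] det_frame_commute[OF n2, of c e z] det_frame_commute[OF n2, of c f e]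
    by (simp add: det_frame_same[OF n2])
  moreover have "det (frame c f z) = - inner z e * det (frame c e f)"
    using 1[of z f] det_frame_commute[OF n2, of c f z] by (simp add: det_frame_same[OF n2])
  ultimately show ?thesis by (simp add: 1[of w z] algebra_simps)
qed

text \<open>A kernel vector is orthogonal to every row, hence zero by
  \<open>complement_basis_eq_0\<close>.\<close>

lemma det_frame_nonzero:
  fixes c :: "nat \<Rightarrow> (real,'n::{finite,wellorder}) vec"
  assumes n2: "CARD('n) \<ge> 2" and b: "complement_basis c e f"
  shows "det (frame c e f) \<noteq> 0"
proof -
  obtain p q :: 'n where "last_two p q" using last_two_exists[OF n2] .
  note pq = last_twoD[OF this]
  have "x = 0" if "frame c e f *v x = 0" for x
  proof (rule complement_basis_eq_0[OF b])
    have row: "inner (frame c e f $ j) x = 0" for j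
      using that by (simp add: matrix_mult_dot vec_eq_iff)
    show "inner x e = 0" using row[of p] pq by (simp add: frame_def inner_commute)
    show "inner x f = 0" using row[of q] pq by (simp add: frame_def inner_commute)
    fix k assume "k \<in> {1..CARD('n) - 2}"
    then obtain j where "j \<noteq> p" "j \<noteq> q" "pos j + 1 = k" using pq(4) by blast
    then show "inner (c k) x = 0" using row[of j] pq by (auto simp: frame_def)
  qed
  then have "\<exists>B. B ** frame c e f = mat 1" using matrix_left_invertible_ker by blast
  then show ?thesis using invertible_left_inverse invertible_det_nz by blast
qed

section \<open>The inner product of multivectors as a determinant\<close>

text \<open>A permutation that moves an index outside \<open>S\<close> picks an off-diagonal zero of
  an identity row, so only the permutations of \<open>S\<close> contribute to the Leibniz
  sum.\<close>

lemma det_identity_rows_outside: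
  fixes A :: "real^'n^'n"
  assumes A: "\<And>i. i \<notin> S \<Longrightarrow> A $ i = axis i 1"
  shows "det A = (\<Sum>p | p permutes S. of_int (sign p) * (\<Prod>i\<in>S. A $ i $ p i))"
proof -
  have "det A = (\<Sum>p | p permutes S. of_int (sign p) * (\<Prod>i\<in>UNIV. A $ i $ p i))"
    unfolding det_def
  proof (rule sum.mono_neutral_right)
    show "{p. p permutes S} \<subseteq> {p. p permutes UNIV}" by (auto intro: permutes_subset)
    show "\<forall>p\<in>{p. p permutes UNIV} - {p. p permutes S}. of_int (sign p) * (\<Prod>i\<in>UNIV. A $ i $ p i) = 0"
    proof
      fix p assume "p \<in> {p. p permutes UNIV} - {p. p permutes S}"
      then obtain i where "i \<notin> S" "p i \<noteq> i"
        using permutes_superset[of p UNIV S] by auto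
      then have "A $ i $ p i = 0" using A by (simp add: axis_def)
      then show "of_int (sign p) * (\<Prod>i\<in>UNIV. A $ i $ p i) = 0" by (simp add: prod_zero_iff) blast
    qed
  qed (simp add: finite_permutations)
  also have "\<dots> = (\<Sum>p | p permutes S. of_int (sign p) * (\<Prod>i\<in>S. A $ i $ p i))"
  proof (intro sum.cong refl)
    fix p assume "p \<in> {p. p permutes S}"
    then have "A $ i $ p i = 1" if "i \<notin> S" for i
      using A that by (simp add: permutes_not_in axis_def)
    then have "(\<Prod>i\<in>UNIV. A $ i $ p i) = (\<Prod>i\<in>S. A $ i $ p i)"
      by (intro prod.mono_neutral_right) auto
    then show "of_int (sign p) * (\<Prod>i\<in>UNIV. A $ i $ p i) = of_int (sign p) * (\<Prod>i\<in>S. A $ i $ p i)"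
      by simp
  qed
  finally show ?thesis .
qed

text \<open>Conjugation by \<open>g\<close> is a sign-preserving bijection of the two permutation
  groups. It passes from row indices of type \<open>'n\<close> to the labels used in
  \<open>wedge_inner\<close>.\<close>

lemma sum_permutations_reindex:
  fixes a :: "'b \<Rightarrow> 'b \<Rightarrow> real"
  assumes g: "bij_betw g S U" and S: "finite S"
  shows "(\<Sum>p | p permutes S. of_int (sign p) * (\<Prod>i\<in>S. a (g i) (g (p i)))) =
         (\<Sum>p | p permutes U. of_int (sign p) * (\<Prod>i\<in>U. a i (p i)))"
proof -
  have inj: "inj_on g S" and im: "g ` S = U" using g by (auto simp: bij_betw_def)
  have "map_permutation S g = (\<lambda>\<pi> x. if x \<in> U then g (\<pi> (inv_into S g x)) else x)"
    by (auto simp: map_permutation_def im restrict_id_def fun_eq_iff)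
  then have bij: "bij_betw (map_permutation S g) {p. p permutes S} {p. p permutes U}"
    using bij_betw_permutations[OF g] by simp
  show ?thesis
  proof (rule sum.reindex_bij_betw[OF bij, THEN subst[of _ _ "\<lambda>t. _ = t"]], intro sum.cong refl)
    fix p assume "p \<in> {p. p permutes S}"
    then have p: "p permutes S" by simp
    have "(\<Prod>i\<in>U. a i (map_permutation S g p i)) = (\<Prod>i\<in>S. a (g i) (map_permutation S g p (g i)))"
      unfolding im[symmetric] using inj by (simp add: prod.reindex)
    also have "\<dots> = (\<Prod>i\<in>S. a (g i) (g (p i)))"
      using inj by (intro prod.cong refl) (simp add: map_permutation_apply)
    finally show "of_int (sign p) * (\<Prod>i\<in>S. a (g i) (g (p i))) =
        of_int (sign (map_permutation S g p)) * (\<Prod>i\<in>U. a i (map_permutation S g p i))"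
      by (simp add: sign_map_permutation[OF inj p S])
  qed
qed

text \<open>The product of one frame with the transpose of the other has entries
  \<open>inner (u i) (c j)\<close> in its first block. Since \<open>e\<close> and \<open>f\<close>
  are orthonormal and orthogonal to the \<open>c j\<close>, its last two rows are those of the
  identity, whatever \<open>u\<close> is.\<close>

lemma wedge_inner_det_frame:
  fixes c u :: "nat \<Rightarrow> (real,'n::{finite,wellorder}) vec"
  assumes n2: "CARD('n) \<ge> 2" and b: "complement_basis c e f"
  shows "wedge_inner (CARD('n) - 2) u c = det (frame u e f) * det (frame c e f)"
proof -
  obtain p q :: 'n where "last_two p q" using last_two_exists[OF n2] .
  note pq = last_twoD[OF this]
  define S where "S = {j :: 'n. pos j < CARD('n) - 2}"
  have S: "S = - {p, q}" using pq by (auto simp: S_def)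
  let ?g = "\<lambda>j :: 'n. pos j + 1"
  have g: "bij_betw ?g S {1..CARD('n) - 2}"
  proof (rule bij_betw_imageI)
    show "inj_on ?g S" using inj_pos by (auto simp: inj_on_def)
    show "?g ` S = {1..CARD('n) - 2}"
    proof
      show "?g ` S \<subseteq> {1..CARD('n) - 2}" by (auto simp: S_def)
      show "{1..CARD('n) - 2} \<subseteq> ?g ` S" unfolding S using pq(4) by force
    qed
  qed
  let ?P = "frame u e f ** transpose (frame c e f)"
  have ent: "?P $ i $ j = inner (frame u e f $ i) (frame c e f $ j)" for i j
    by (simp add: matrix_matrix_mult_def transpose_def inner_vec_def)
  have on: "inner e e = 1" "inner f f = 1" "inner e f = 0" "inner f e = 0"
    and ck: "\<And>k. k \<in> {1..CARD('n) - 2} \<Longrightarrow> inner e (c k) = 0 \<and> inner f (c k) = 0"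
    using b by (auto simp: complement_basis_def inner_commute)
  have ck': "inner e (c (pos j + 1)) = 0 \<and> inner f (c (pos j + 1)) = 0" if "j \<noteq> p" "j \<noteq> q" for j
    using pq(2)[of j] ck[of "pos j + 1"] that by simp
  have "det ?P = (\<Sum>\<sigma> | \<sigma> permutes S. of_int (sign \<sigma>) * (\<Prod>i\<in>S. ?P $ i $ \<sigma> i))"
  proof (rule det_identity_rows_outside)
    fix i assume "i \<notin> S"
    then consider "i = p" | "i = q" using S by auto
    then show "?P $ i = axis i 1"
    proof cases
      case 1
      have "inner e (frame c e f $ j) = axis p 1 $ j" for j
        using pq on ck'[of j] by (auto simp: frame_def axis_def)
      then show ?thesis using 1 pq unfolding vec_eq_iff ent by (simp add: frame_def)
    next
      case 2
      have "inner f (frame c e f $ j) = axis q 1 $ j" for j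
        using pq on ck'[of j] by (auto simp: frame_def axis_def)
      then show ?thesis using 2 pq unfolding vec_eq_iff ent by (simp add: frame_def)
    qed
  qed
  also have "\<dots> = (\<Sum>\<sigma> | \<sigma> permutes S. of_int (sign \<sigma>) * (\<Prod>i\<in>S. inner (u (?g i)) (c (?g (\<sigma> i)))))"
  proof (intro sum.cong refl arg_cong2[of _ _ _ _ "(*)"] prod.cong)
    fix \<sigma> i assume "\<sigma> \<in> {\<sigma>. \<sigma> permutes S}" "i \<in> S"
    then have "\<sigma> i \<in> S" by (simp add: permutes_in_image)
    then show "?P $ i $ \<sigma> i = inner (u (?g i)) (c (?g (\<sigma> i)))"
      using \<open>i \<in> S\<close> unfolding ent by (simp add: frame_def S_def)
  qed
  also have "\<dots> = wedge_inner (CARD('n) - 2) u c"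
    unfolding wedge_inner_def
    by (rule sum_permutations_reindex[OF g, of "\<lambda>i j. inner (u i) (c j)"]) simp
  finally show ?thesis by (simp add: det_mul det_transpose)
qed

lemma det_wedge_inner_inverse:
  fixes A :: "((real,'n::{finite,wellorder}) vec,'n) vec"
  assumes n2: "CARD('n) \<ge> 2" and b: "complement_basis c e f" and A: "det A \<noteq> 0"
  shows "det A * wedge_inner (CARD('n) - 2) (\<lambda>k. matrix_inv A *v c k) c
       = (det (frame c e f))\<^sup>2 * (inner (A *v e) e * inner (A *v f) f - inner (A *v e) f * inner (A *v f) e)"
proof -
  let ?u = "\<lambda>k. matrix_inv A *v c k"
  have inv: "A ** matrix_inv A = mat 1" 
    using A unfolding matrix_inv_def invertible_det_nz[symmetric] invertible_def
    by (rule someI2_ex) simp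
  have "A *v (?u k) = c k" for k by (simp add: matrix_vector_mul_assoc inv)
  moreover have "(N ** transpose A) $ i = A *v (N $ i)" for N :: "((real,'n) vec,'n) vec" and i
    by (simp add: vec_eq_iff matrix_matrix_mult_def transpose_def matrix_vector_mult_def mult.commute)
  \<comment> \<open>Multiplication by \<open>transpose A\<close> on the right applies
    \<open>A\<close> to each row, which undoes the inverse in the first n-2 rows.\<close>
  ultimately have "frame ?u e f ** transpose A = frame c (A *v e) (A *v f)"
    by (subst vec_eq_iff) (simp add: frame_def)
  then have "det (frame ?u e f) * det A = det (frame c (A *v e) (A *v f))"
    by (metis det_mul det_transpose)
  also have "\<dots> = det (frame c e f) * (inner (A *v e) e * inner (A *v f) f - inner (A *v e) f * inner (A *v f) e)"
    by (rule det_frame_complement_basis[OF n2 b])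
  finally show ?thesis
    unfolding wedge_inner_det_frame[OF n2 b] by algebra
qed

section \<open>Gradients and Hessians\<close>

lemma has_derivative_grad:
  fixes f :: "(real,'n::finite) vec \<Rightarrow> real"
  assumes "f differentiable (at x)"
  shows "(f has_derivative (\<lambda>h. inner (grad f x) h)) (at x)"
proof -
  let ?D = "frechet_derivative f (at x)"
  have D: "(f has_derivative ?D) (at x)" using assms frechet_derivative_works by blast
  then have lin: "linear ?D" by (rule has_derivative_linear)
  have "?D h = inner (grad f x) h" for h
  proof -
    have "?D h = ?D (\<Sum>l\<in>UNIV. h $ l *s axis l 1)" by (simp add: basis_expansion)
    also have "\<dots> = inner (grad f x) h"
      by (simp add: linear_sum[OF lin] linear_scale[OF lin] scalar_mult_eq_scaleR inner_vec_def
          grad_def partial_def mult.commute)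
    finally show ?thesis .
  qed
  then have "?D = (\<lambda>h. inner (grad f x) h)" by (rule ext)
  then show ?thesis using D by simp
qed

lemma grad_eqI:
  assumes "(f has_derivative (\<lambda>h. inner g h)) (at x)"
  shows "grad f x = g"
  unfolding vec_eq_iff grad_def partial_def frechet_derivative_at[OF assms, symmetric]
  by (simp add: inner_axis)

lemma has_derivative_vec:
  fixes f :: "'a::real_normed_vector \<Rightarrow> (real,'n::finite) vec"
  assumes "\<And>i. ((\<lambda>x. f x $ i) has_derivative (\<lambda>h. f' h $ i)) (at x)"
  shows "(f has_derivative f') (at x)"
  by (rule has_derivative_componentwise_within[THEN iffD2])
    (use assms in \<open>auto simp: Basis_vec_def inner_axis\<close>)

lemma has_derivative_grad_hess:
  fixes f :: "(real,'n::finite) vec \<Rightarrow> real"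
  assumes "grad f differentiable (at x)"
  shows "(grad f has_derivative (*v) (hess f x)) (at x)"
proof (rule has_derivative_vec)
  fix i
  have "(\<lambda>y. grad f y $ i) differentiable (at x)"
    using assms unfolding differentiable_def by (auto intro: bounded_linear.has_derivative[OF bounded_linear_vec_nth])
  from has_derivative_grad[OF this]
  show "((\<lambda>y. grad f y $ i) has_derivative (\<lambda>h. (hess f x *v h) $ i)) (at x)"
    by (simp add: matrix_mult_dot hess_def grad_def[of "\<lambda>y. grad f y $ i"])
qed

lemma smooth_on_differentiable:
  assumes "smooth_on \<Omega> f" "open \<Omega>" "x \<in> \<Omega>"
  shows "f differentiable (at x)"
proof -
  have "Ck_on (Suc 0) \<Omega> f" using assms(1) unfolding smooth_on_def by blast
  then have "f differentiable_on \<Omega>" by simp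
  then show ?thesis using assms(2,3) by (simp add: differentiable_on_eq_differentiable_at)
qed

lemma smooth_on_partial: "smooth_on \<Omega> f \<Longrightarrow> smooth_on \<Omega> (partial f l)"
  unfolding smooth_on_def by (metis Ck_on.simps(2))

lemma smooth_on_has_derivative:
  assumes "smooth_on \<Omega> f" "open \<Omega>" "x \<in> \<Omega>"
  shows "(f has_derivative (\<lambda>h. inner (grad f x) h)) (at x)"
  by (rule has_derivative_grad[OF smooth_on_differentiable[OF assms]])

lemma smooth_on_grad_differentiable:
  assumes "smooth_on \<Omega> f" "open \<Omega>" "x \<in> \<Omega>"
  shows "grad f differentiable (at x)"
proof -
  have "(grad f has_derivative (\<lambda>h. \<chi> i. inner (grad (partial f i) x) h)) (at x)"
    using smooth_on_has_derivative[OF smooth_on_partial[OF assms(1)] assms(2,3)]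
    by (intro has_derivative_vec) (simp add: grad_def)
  then show ?thesis by (auto simp: differentiable_def)
qed

lemma smooth_on_continuous_grad:
  assumes "smooth_on \<Omega> f" "open \<Omega>"
  shows "continuous_on \<Omega> (grad f)"
  using smooth_on_grad_differentiable[OF assms]
  by (meson continuous_at_imp_continuous_on differentiable_imp_continuous_within)

section \<open>Lipschitz estimates on compact sets\<close>

text \<open>Compactness bounds the gradient, and convexity lets the mean value inequality turn this
  into a Lipschitz constant.\<close>

lemma smooth_on_lipschitz:
  assumes f: "smooth_on \<Omega> f" "open \<Omega>" and S: "compact S" "convex S" "S \<subseteq> \<Omega>"
  shows "\<exists>L. L-lipschitz_on S f"
proof -
  have "bounded (grad f ` S)"
    by (intro compact_imp_bounded compact_continuous_image S
        continuous_on_subset[OF smooth_on_continuous_grad[OF f]])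
  then obtain B where B: "0 < B" "\<And>x. x \<in> S \<Longrightarrow> norm (grad f x) \<le> B"
    by (auto simp: bounded_pos)
  have "B-lipschitz_on S f"
  proof (rule bounded_derivative_imp_lipschitz)
    show "(f has_derivative (\<lambda>h. inner (grad f x) h)) (at x within S)" if "x \<in> S" for x
      using smooth_on_has_derivative[OF f] that S by (auto intro: has_derivative_at_withinI)
    show "onorm (\<lambda>h. inner (grad f x) h) \<le> B" if "x \<in> S" for x
    proof (rule onorm_le)
      fix h
      have "norm (inner (grad f x) h) \<le> norm (grad f x) * norm h" using Cauchy_Schwarz_ineq2 by simp
      also have "\<dots> \<le> B * norm h" using B that by (intro mult_right_mono) auto
      finally show "norm (inner (grad f x) h) \<le> B * norm h" .
    qed
  qed (use B S in auto)
  then show ?thesis ..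
qed

lemma lipschitz_on_mult_compact:
  fixes f g :: "'a::metric_space \<Rightarrow> real"
  assumes "\<exists>L. L-lipschitz_on S f" "\<exists>L. L-lipschitz_on S g" and S: "compact S"
  shows "\<exists>L. L-lipschitz_on S (\<lambda>x. f x * g x)"
proof -
  obtain L M where L: "L-lipschitz_on S f" and M: "M-lipschitz_on S g" using assms by blast
  have "bounded (f ` S)" "bounded (g ` S)"
    using L M S by (auto intro!: compact_imp_bounded compact_continuous_image lipschitz_on_continuous_on)
  then obtain a b where a: "0 < a" "\<And>x. x \<in> S \<Longrightarrow> \<bar>f x\<bar> \<le> a" and b: "0 < b" "\<And>x. x \<in> S \<Longrightarrow> \<bar>g x\<bar> \<le> b"
    by (auto simp: bounded_pos)
  have L0: "0 \<le> L" and M0: "0 \<le> M" using L M lipschitz_on_nonneg by auto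
  have "(a * M + b * L)-lipschitz_on S (\<lambda>x. f x * g x)"
  proof (rule lipschitz_onI)
    fix x y assume xy: "x \<in> S" "y \<in> S"
    have "f x * g x - f y * g y = f x * (g x - g y) + g y * (f x - f y)" by (simp add: algebra_simps)
    then have "dist (f x * g x) (f y * g y) \<le> \<bar>f x\<bar> * dist (g x) (g y) + \<bar>g y\<bar> * dist (f x) (f y)"
      by (simp add: dist_real_def) (metis abs_mult abs_triangle_ineq)
    also have "\<dots> \<le> a * (M * dist x y) + b * (L * dist x y)"
      using a b lipschitz_onD[OF L xy] lipschitz_onD[OF M xy] xy
      by (intro add_mono mult_mono) auto
    finally show "dist (f x * g x) (f y * g y) \<le> (a * M + b * L) * dist x y" by (simp add: algebra_simps)
  qed (use a b L0 M0 in auto)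
  then show ?thesis ..
qed

lemma lipschitz_on_prod_compact:
  fixes f :: "'i \<Rightarrow> 'a::metric_space \<Rightarrow> real"
  assumes "\<And>i. i \<in> I \<Longrightarrow> \<exists>L. L-lipschitz_on S (f i)" "compact S"
  shows "\<exists>L. L-lipschitz_on S (\<lambda>x. \<Prod>i\<in>I. f i x)"
  using assms(1)
proof (induction I rule: infinite_finite_induct)
  case (insert i I)
  then show ?case using lipschitz_on_mult_compact[OF _ _ assms(2), of "f i"] by simp
qed (auto intro: exI[of _ 0] lipschitz_on_constant)

lemma lipschitz_on_sum:
  fixes f :: "'i \<Rightarrow> 'a::metric_space \<Rightarrow> real"
  assumes "\<And>i. i \<in> I \<Longrightarrow> \<exists>L. L-lipschitz_on S (f i)"
  shows "\<exists>L. L-lipschitz_on S (\<lambda>x. \<Sum>i\<in>I. f i x)"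
  using assms
proof (induction I rule: infinite_finite_induct)
  case (insert i I)
  then obtain L M where "L-lipschitz_on S (f i)" "M-lipschitz_on S (\<lambda>x. \<Sum>i\<in>I. f i x)" by blast
  from lipschitz_on_add[OF this] show ?case using insert by auto
qed (auto intro: exI[of _ 0] lipschitz_on_constant)

lemma lipschitz_on_det:
  fixes A :: "'a::metric_space \<Rightarrow> real^'n^'n"
  assumes "\<And>i j. \<exists>L. L-lipschitz_on S (\<lambda>x. A x $ i $ j)" "compact S"
  shows "\<exists>L. L-lipschitz_on S (\<lambda>x. det (A x))"
  unfolding det_def
  by (intro lipschitz_on_sum lipschitz_on_mult_compact lipschitz_on_prod_compact assms)
    (auto intro: exI[of _ 0] lipschitz_on_constant)

lemma lipschitz_on_vec:
  fixes f :: "'a::metric_space \<Rightarrow> (real,'n::finite) vec"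
  assumes "\<And>i. \<exists>L. L-lipschitz_on S (\<lambda>x. f x $ i)"
  shows "\<exists>L. L-lipschitz_on S f"
proof -
  obtain L where L: "\<And>i. (L i)-lipschitz_on S (\<lambda>x. f x $ i)" using assms by metis
  have "(\<Sum>i\<in>UNIV. L i)-lipschitz_on S f"
  proof (rule lipschitz_onI)
    fix x y assume xy: "x \<in> S" "y \<in> S"
    have "dist (f x) (f y) \<le> (\<Sum>i\<in>UNIV. \<bar>(f x - f y) $ i\<bar>)" unfolding dist_norm by (rule norm_le_l1_cart)
    also have "\<dots> \<le> (\<Sum>i\<in>UNIV. L i * dist x y)"
      using lipschitz_onD[OF L xy] by (intro sum_mono) (simp add: dist_real_def)
    finally show "dist (f x) (f y) \<le> (\<Sum>i\<in>UNIV. L i) * dist x y" by (simp add: sum_distrib_right)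
  qed (use L lipschitz_on_nonneg in \<open>auto intro!: sum_nonneg\<close>)
  then show ?thesis ..
qed

section \<open>Second-order expansion and symmetry of the Hessian\<close>

lemma has_derivative_bound:
  assumes "(g has_derivative g') (at x)" "0 < \<eta>"
  obtains \<delta> where "0 < \<delta>" "\<And>h. norm h < \<delta> \<Longrightarrow> norm (g (x + h) - g x - g' h) \<le> \<eta> * norm h"
proof -
  obtain d where d: "0 < d" "\<And>y. norm (y - x) < d \<Longrightarrow> norm (g y - g x - g' (y - x)) \<le> \<eta> * norm (y - x)"
    using assms unfolding has_derivative_at_alt by blast
  show ?thesis by (rule that[OF d(1)]) (use d(2)[of "x + _"] in simp)
qed

context
  fixes F :: "(real,'n::finite) vec \<Rightarrow> real" and g xe and A :: "((real,'n) vec,'n) vec" and r :: real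
  assumes r: "0 < r" and F: "\<And>y. y \<in> ball xe r \<Longrightarrow> (F has_derivative (\<lambda>h. inner (g y) h)) (at y)"
    and g: "(g has_derivative (*v) A) (at xe)"
begin

lemma along_line:
  assumes "xe + p + s *\<^sub>R q \<in> ball xe r"
  shows "((\<lambda>s. F (xe + p + s *\<^sub>R q)) has_real_derivative inner (g (xe + p + s *\<^sub>R q)) q) (at s within I)"
  by (rule has_real_derivative_along_curve[where x = "\<lambda>s. xe + p + s *\<^sub>R q"]) (auto intro!: F assms derivative_eq_intros)

text \<open>The gradient \<open>g\<close> is differentiable only at \<open>xe\<close>, so the mean
  value theorem is applied once, to the remainder along the segment; the first-order remainder of
  \<open>g\<close> at \<open>xe\<close> bounds the result.\<close>

lemma taylor_second_order:
  assumes \<eta>: "0 < \<eta>"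
  obtains \<delta> where "0 < \<delta>"
    "\<And>h. norm h < \<delta> \<Longrightarrow> \<bar>F (xe + h) - F xe - inner (g xe) h - inner (A *v h) h / 2\<bar> \<le> \<eta> * (norm h)\<^sup>2"
proof -
  obtain d where d: "0 < d" "\<And>h. norm h < d \<Longrightarrow> norm (g (xe + h) - g xe - A *v h) \<le> \<eta> * norm h"
    using has_derivative_bound[OF g \<eta>] by blast
  have "\<bar>F (xe + h) - F xe - inner (g xe) h - inner (A *v h) h / 2\<bar> \<le> \<eta> * (norm h)\<^sup>2"
    if h: "norm h < min d r" for h
  proof -
    \<comment> \<open>The summand 0 matches the form of \<open>along_line\<close>.\<close>
    let ?\<psi> = "\<lambda>s. F (xe + 0 + s *\<^sub>R h) - s * inner (g xe) h - s\<^sup>2 / 2 * inner (A *v h) h"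
    let ?\<psi>' = "\<lambda>s. inner (g (xe + 0 + s *\<^sub>R h)) h - inner (g xe) h - s * inner (A *v h) h"
    have sh: "norm (s *\<^sub>R h) \<le> norm h" if "0 \<le> s" "s \<le> 1" for s
      using that by (simp add: mult_left_le_one_le)
    have "(?\<psi> has_real_derivative ?\<psi>' s) (at s)" if "0 \<le> s" "s \<le> 1" for s
      by (rule derivative_eq_intros along_line refl | use h sh[OF that] in \<open>simp add: dist_norm\<close>)+
    then obtain s where s: "0 < s" "s < 1" "?\<psi> 1 - ?\<psi> 0 = (1 - 0) * ?\<psi>' s"
      using MVT2[of 0 1 ?\<psi> ?\<psi>'] by auto
    have "?\<psi>' s = inner (g (xe + s *\<^sub>R h) - g xe - A *v (s *\<^sub>R h)) h"
      by (simp add: inner_diff_left matrix_vector_mult_scaleR)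
    also have "\<bar>\<dots>\<bar> \<le> norm (g (xe + s *\<^sub>R h) - g xe - A *v (s *\<^sub>R h)) * norm h"
      by (rule Cauchy_Schwarz_ineq2)
    also have "\<dots> \<le> (\<eta> * norm (s *\<^sub>R h)) * norm h"
      using d(2)[of "s *\<^sub>R h"] h sh[of s] s by (intro mult_right_mono) auto
    also have "\<dots> \<le> (\<eta> * norm h) * norm h"
      using sh[of s] s \<eta> by (intro mult_right_mono mult_left_mono) auto
    finally show ?thesis using s(3) by (simp add: power2_eq_square mult.assoc)
  qed
  then show ?thesis using that[of "min d r"] d r by auto
qed

text \<open>The mean value theorem in direction \<open>v\<close>, applied to the increment of
  \<open>F\<close> under the shift by \<open>t u\<close>, leaves a difference of two values of
  \<open>g\<close>; expanding both at \<open>xe\<close> gives the bilinear term.\<close>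

lemma second_difference:
  assumes \<eta>: "0 < \<eta>"
  obtains \<delta> where "0 < \<delta>"
    "\<And>t. 0 < t \<Longrightarrow> t < \<delta> \<Longrightarrow>
      \<bar>F (xe + t *\<^sub>R u + t *\<^sub>R v) - F (xe + t *\<^sub>R u) - F (xe + t *\<^sub>R v) + F xe - t\<^sup>2 * inner (A *v u) v\<bar> \<le> \<eta> * t\<^sup>2"
proof -
  \<comment> \<open>Then \<open>t * N\<close> bounds every displacement from \<open>xe\<close> on
    both segments; the summand 1 keeps \<open>N\<close> positive.\<close>
  define N where "N = norm u + norm v + 1"
  have N: "0 < N" "norm u \<le> N" "norm v \<le> N" "norm u + norm v \<le> N"
    using norm_ge_zero[of u] norm_ge_zero[of v] unfolding N_def by linarith+
  \<comment> \<open>Two remainders of size \<open>\<theta> * (t * N)\<close> are paired with a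
    vector of norm at most \<open>t * N\<close>, which adds up to
    \<open>\<eta> * t\<^sup>2\<close>.\<close>
  define \<theta> where "\<theta> = \<eta> / (2 * N * N)"
  have \<theta>: "0 < \<theta>" using \<eta> N by (simp add: \<theta>_def)
  obtain d where d: "0 < d" "\<And>h. norm h < d \<Longrightarrow> norm (g (xe + h) - g xe - A *v h) \<le> \<theta> * norm h"
    using has_derivative_bound[OF g \<theta>] by blast
  have "\<bar>F (xe + t *\<^sub>R u + t *\<^sub>R v) - F (xe + t *\<^sub>R u) - F (xe + t *\<^sub>R v) + F xe - t\<^sup>2 * inner (A *v u) v\<bar> \<le> \<eta> * t\<^sup>2"
    if t: "0 < t" "t < min d r / N" for t
  proof -
    let ?q = "t *\<^sub>R v"
    let ?\<psi> = "\<lambda>s. F (xe + t *\<^sub>R u + s *\<^sub>R ?q) - F (xe + 0 + s *\<^sub>R ?q)"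
    let ?\<psi>' = "\<lambda>s. inner (g (xe + t *\<^sub>R u + s *\<^sub>R ?q)) ?q - inner (g (xe + 0 + s *\<^sub>R ?q)) ?q"
    have tN: "t * N < min d r" using t N by (simp add: pos_less_divide_eq)
    have n1: "norm (t *\<^sub>R u + s *\<^sub>R ?q) \<le> t * N" "norm (s *\<^sub>R ?q) \<le> t * N" if "0 \<le> s" "s \<le> 1" for s
    proof -
      have "norm (s *\<^sub>R ?q) = s * (t * norm v)" using that t by simp
      also have "\<dots> \<le> t * norm v" using that t by (intro mult_left_le_one_le) auto
      finally have 1: "norm (s *\<^sub>R ?q) \<le> t * norm v" .
      also have "\<dots> \<le> t * N" using t N by simp
      finally show "norm (s *\<^sub>R ?q) \<le> t * N" .
      have "norm (t *\<^sub>R u + s *\<^sub>R ?q) \<le> t * norm u + t * norm v"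
        using norm_triangle_ineq[of "t *\<^sub>R u" "s *\<^sub>R ?q"] 1 t by simp
      also have "\<dots> = t * (norm u + norm v)" by (simp add: algebra_simps)
      also have "\<dots> \<le> t * N" using t N by simp
      finally show "norm (t *\<^sub>R u + s *\<^sub>R ?q) \<le> t * N" .
    qed
    have "(?\<psi> has_real_derivative ?\<psi>' s) (at s)" if "0 \<le> s" "s \<le> 1" for s
    proof (intro DERIV_diff along_line)
      show "xe + t *\<^sub>R u + s *\<^sub>R ?q \<in> ball xe r"
        using n1(1)[OF that] tN norm_minus_cancel[of "t *\<^sub>R u + s *\<^sub>R ?q"] by (simp add: dist_norm add.assoc)
      show "xe + 0 + s *\<^sub>R ?q \<in> ball xe r" using n1(2)[OF that] tN by (simp add: dist_norm)
    qed
    then obtain s where s: "0 < s" "s < 1" "?\<psi> 1 - ?\<psi> 0 = (1 - 0) * ?\<psi>' s"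
      using MVT2[of 0 1 ?\<psi> ?\<psi>'] by auto
    let ?R = "\<lambda>h. g (xe + h) - g xe - A *v h"
    have R: "norm (?R h) \<le> \<theta> * (t * N)" if "norm h \<le> t * N" for h
    proof -
      have "norm (?R h) \<le> \<theta> * norm h" using d(2)[of h] that tN by simp
      also have "\<dots> \<le> \<theta> * (t * N)" using that \<theta> by simp
      finally show ?thesis .
    qed
    have "?\<psi>' s - t\<^sup>2 * inner (A *v u) v = inner (?R (t *\<^sub>R u + s *\<^sub>R ?q) - ?R (s *\<^sub>R ?q)) ?q"
      by (simp add: inner_diff_left matrix_vector_mult_scaleR matrix_vector_right_distrib add.assoc
          inner_add_left power2_eq_square algebra_simps)
    also have "\<bar>\<dots>\<bar> \<le> norm (?R (t *\<^sub>R u + s *\<^sub>R ?q) - ?R (s *\<^sub>R ?q)) * norm ?q"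
      by (rule Cauchy_Schwarz_ineq2)
    also have "\<dots> \<le> (\<theta> * (t * N) + \<theta> * (t * N)) * (t * N)"
      using n1[of s] s R t N \<theta>
      by (intro mult_mono order_trans[OF norm_triangle_ineq4] add_mono R) auto
    also have "\<dots> = \<eta> * t\<^sup>2" using N by (simp add: \<theta>_def power2_eq_square field_simps)
    finally show ?thesis using s(3) by (simp add: algebra_simps)
  qed
  then show ?thesis using that[of "min d r / N"] d r N by auto
qed

text \<open>The second difference is symmetric in \<open>u\<close> and \<open>v\<close>. With errors
  of one third of the supposed gap each, the two expansions of it contradict each other.\<close>

lemma second_derivative_symmetric: "inner (A *v u) v = inner (A *v v) u"
proof (rule ccontr)
  assume "\<not> ?thesis"
  then have \<eta>: "0 < \<bar>inner (A *v u) v - inner (A *v v) u\<bar> / 3" (is "0 < ?\<eta>") by simp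
  obtain d1 where d1: "0 < d1" "\<And>t. 0 < t \<Longrightarrow> t < d1 \<Longrightarrow>
      \<bar>F (xe + t *\<^sub>R u + t *\<^sub>R v) - F (xe + t *\<^sub>R u) - F (xe + t *\<^sub>R v) + F xe - t\<^sup>2 * inner (A *v u) v\<bar> \<le> ?\<eta> * t\<^sup>2"
    using second_difference[OF \<eta>, of u v] by blast
  obtain d2 where d2: "0 < d2" "\<And>t. 0 < t \<Longrightarrow> t < d2 \<Longrightarrow>
      \<bar>F (xe + t *\<^sub>R v + t *\<^sub>R u) - F (xe + t *\<^sub>R v) - F (xe + t *\<^sub>R u) + F xe - t\<^sup>2 * inner (A *v v) u\<bar> \<le> ?\<eta> * t\<^sup>2"
    using second_difference[OF \<eta>, of v u] by blast
  define t where "t = min d1 d2 / 2"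
  have t: "0 < t" "t < d1" "t < d2" using d1 d2 by (auto simp: t_def)
  have "\<bar>t\<^sup>2 * inner (A *v u) v - t\<^sup>2 * inner (A *v v) u\<bar> \<le> 2 * ?\<eta> * t\<^sup>2"
    using d1(2)[OF t(1,2)] d2(2)[OF t(1,3)]
    unfolding add.assoc[of xe] add.commute[of "t *\<^sub>R v"] by linarith
  then have "t\<^sup>2 * \<bar>inner (A *v u) v - inner (A *v v) u\<bar> \<le> t\<^sup>2 * (2 * ?\<eta>)"
    unfolding right_diff_distrib[symmetric] abs_mult by simp
  then show False using t \<eta> by simp
qed

end

section \<open>Quadratic forms and instability\<close>

lemma quadratic_coercive:
  fixes q :: "'a::euclidean_space \<Rightarrow> real"
  assumes cont: "continuous_on UNIV q" and hom: "\<And>s h. q (s *\<^sub>R h) = s\<^sup>2 * q h"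
    and pos: "\<And>h. h \<noteq> 0 \<Longrightarrow> 0 < q h"
  obtains \<alpha> where "0 < \<alpha>" "\<And>h. \<alpha> * (norm h)\<^sup>2 \<le> q h"
proof -
  have "sphere (0::'a) 1 \<noteq> {}" by simp
  then obtain w where w: "w \<in> sphere 0 1" "\<And>y. y \<in> sphere 0 1 \<Longrightarrow> q w \<le> q y"
    using continuous_attains_inf[OF compact_sphere _ continuous_on_subset[OF cont subset_UNIV]] by metis
  have "q w * (norm h)\<^sup>2 \<le> q h" for h
  proof (cases "h = 0")
    case True then show ?thesis using hom[of 0 0] by simp
  next
    case False
    have "q h = (norm h)\<^sup>2 * q (h /\<^sub>R norm h)" using hom[of "norm h" "h /\<^sub>R norm h"] False by simp
    moreover have "q w \<le> q (h /\<^sub>R norm h)" using False by (intro w) simp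
    ultimately show ?thesis by (metis mult.commute mult_left_mono zero_le_power2)
  qed
  moreover have "0 < q w" using w(1) by (intro pos) auto
  ultimately show ?thesis using that by blast
qed

text \<open>Chetaev's theorem for the function \<open>B h h\<close> with \<open>h = y - xe\<close>:
  near \<open>xe\<close> the nonlinear remainder of \<open>X\<close> is dominated by the growth
  along the linear part.\<close>

theorem quadratic_chetaev_unstable:
  fixes X :: "(real,'n::finite) vec \<Rightarrow> (real,'n) vec"
  assumes X: "(X has_derivative D) (at xe)" "X xe = 0" and B: "bounded_bilinear B"
    and \<alpha>: "0 < \<alpha>" "\<And>h. 0 < B h h \<Longrightarrow> \<alpha> * (norm h)\<^sup>2 \<le> B h (D h) + B (D h) h"
    and v: "0 < (B v v :: real)"
  shows "unstable X \<Omega> xe"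
proof -
  interpret B: bounded_bilinear B by (rule B)
  obtain K where K: "0 < K" "\<And>a b. \<bar>B a b\<bar> \<le> norm a * norm b * K" using B.pos_bounded by auto
  \<comment> \<open>The remainder of \<open>X\<close> then costs at most \<alpha>/4 times the
    squared norm in each slot of \<open>B\<close>. The half of \<alpha> that is left dominates
    \<open>\<alpha> / (2 * K) * V\<close>, since \<open>V\<close> is at most \<open>K\<close> times
    the squared norm.\<close>
  have \<eta>: "0 < \<alpha> / (4 * K)" (is "0 < ?\<eta>") using \<alpha> K by simp
  obtain r where r: "0 < r" "\<And>h. norm h < r \<Longrightarrow> norm (X (xe + h) - D h) \<le> ?\<eta> * norm h"
    using has_derivative_bound[OF X(1) \<eta>] X(2) by auto
  define V where "V y = B (y - xe) (y - xe)" for y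
  show ?thesis
  proof (rule chetaev_unstable[where r = r and c = "\<alpha> / (2 * K)" and V = V and M = "r * r * K"
        and V' = "\<lambda>y h. B (y - xe) h + B h (y - xe)"])
    show "0 < r" by fact
    show "0 < \<alpha> / (2 * K)" using \<alpha> K by simp
    show "(V has_derivative (\<lambda>h. B (y - xe) h + B h (y - xe))) (at y)" for y
      unfolding V_def by (rule B.FDERIV[of "\<lambda>y. y - xe" "\<lambda>h. h" y UNIV "\<lambda>y. y - xe" "\<lambda>h. h"])
        (auto intro!: derivative_eq_intros)
    show "V y \<le> r * r * K" if "y \<in> ball xe r" for y
    proof -
      have "norm (y - xe) \<le> r" using that by (simp add: dist_norm norm_minus_commute)
      then have "norm (y - xe) * norm (y - xe) * K \<le> r * r * K"
        using K r by (intro mult_right_mono mult_mono) auto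
      then show ?thesis using K(2)[of "y - xe" "y - xe"] by (simp add: V_def)
    qed
    show "\<alpha> / (2 * K) * V y \<le> B (y - xe) (X y) + B (X y) (y - xe)" if y: "y \<in> ball xe r" "0 < V y" for y
    proof -
      define h where "h = y - xe"
      define R where "R = X y - D h"
      have h: "norm h < r" using y by (simp add: h_def dist_norm norm_minus_commute)
      have R: "norm R \<le> ?\<eta> * norm h" using r(2)[OF h] by (simp add: R_def h_def)
      have XR: "X y = D h + R" by (simp add: R_def)
      have e: "norm h * norm R * K \<le> \<alpha> / 4 * (norm h)\<^sup>2"
      proof -
        have "norm h * norm R * K \<le> norm h * (?\<eta> * norm h) * K"
          using R K by (intro mult_right_mono mult_left_mono) auto
        also have "\<dots> = \<alpha> / 4 * (norm h)\<^sup>2" using K by (simp add: power2_eq_square field_simps)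
        finally show ?thesis .
      qed
      have "\<alpha> * (norm h)\<^sup>2 \<le> B h (D h) + B (D h) h" using y by (intro \<alpha>) (simp add: V_def h_def)
      moreover have "\<bar>B h R\<bar> \<le> \<alpha> / 4 * (norm h)\<^sup>2" "\<bar>B R h\<bar> \<le> \<alpha> / 4 * (norm h)\<^sup>2"
        using K(2)[of h R] K(2)[of R h] e by (simp_all add: mult.commute)
      moreover have "\<alpha> / (2 * K) * V y \<le> \<alpha> / 2 * (norm h)\<^sup>2"
      proof -
        have "V y \<le> (norm h)\<^sup>2 * K" using K(2)[of h h] by (simp add: V_def h_def power2_eq_square)
        then have "\<alpha> / (2 * K) * V y \<le> \<alpha> / (2 * K) * ((norm h)\<^sup>2 * K)" using \<alpha> K by (intro mult_left_mono) auto
        then show ?thesis using K by simp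
      qed
      ultimately show ?thesis unfolding h_def[symmetric] XR B.add_left B.add_right by linarith
    qed
    show "\<exists>y. dist y xe < \<delta> \<and> 0 < V y" if \<delta>: "0 < \<delta>" for \<delta>
    proof -
      have "v \<noteq> 0" using v by (auto simp: B.zero_left)
      define s where "s = \<delta> / (2 * norm v)"
      have s: "0 < s" using \<delta> \<open>v \<noteq> 0\<close> by (simp add: s_def)
      have "dist (xe + s *\<^sub>R v) xe < \<delta>" using \<delta> \<open>v \<noteq> 0\<close> s by (simp add: dist_norm s_def)
      moreover have "0 < V (xe + s *\<^sub>R v)" using s v by (simp add: V_def B.scaleR_left B.scaleR_right)
      ultimately show ?thesis by blast
    qed
  qed
qed

section \<open>Equilibria of systems with Casimirs\<close>

lemma differentiable_det:
  fixes A :: "'a::real_normed_vector \<Rightarrow> real^'n^'n"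
  assumes "\<And>i j. (\<lambda>x. A x $ i $ j) differentiable (at x)"
  shows "(\<lambda>x. det (A x)) differentiable (at x)"
proof -
  have "(\<lambda>x. \<Prod>i\<in>UNIV. A x $ i $ p i) differentiable (at x)" for p
  proof -
    define D where "D i = frechet_derivative (\<lambda>x. A x $ i $ p i) (at x)" for i
    have "((\<lambda>x. A x $ i $ p i) has_derivative D i) (at x)" for i
      using assms unfolding D_def frechet_derivative_works by blast
    then have "((\<lambda>x. \<Prod>i\<in>UNIV. A x $ i $ p i) has_derivative
        (\<lambda>y. \<Sum>i\<in>UNIV. D i y * (\<Prod>j\<in>UNIV - {i}. A x $ j $ p j))) (at x)"
      by (intro has_derivative_prod)
    then show ?thesis by (auto simp: differentiable_def)
  qed
  then show ?thesis unfolding det_def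
    by (intro differentiable_sum differentiable_mult differentiable_const) auto
qed

text \<open>The components have \<open>axis i 1\<close> in the first free row; pairing with
  \<open>w\<close> collects them, by linearity, into \<open>w\<close> itself.\<close>

lemma vfield_inner:
  fixes w :: "(real,'n::{finite,wellorder}) vec"
  assumes n2: "CARD('n) \<ge> 2"
  shows "inner (vfield \<nu> C H x) w = \<nu> x * det (frame (\<lambda>k. grad (C k) x) w (grad H x))"
proof -
  let ?d = "\<lambda>w. det (frame (\<lambda>k. grad (C k) x) w (grad H x))"
  note lin = linear_det_frame1[OF n2, of "\<lambda>k. grad (C k) x" "grad H x"]
  have "?d w = ?d (\<Sum>i\<in>UNIV. w $ i *s axis i 1)" by (simp add: basis_expansion)
  also have "\<dots> = (\<Sum>i\<in>UNIV. w $ i * ?d (axis i 1))"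
    by (simp add: linear_sum[OF lin] linear_scale[OF lin] scalar_mult_eq_scaleR)
  finally show ?thesis
    by (simp add: inner_vec_def vfield_def jac_det_frame sum_distrib_left mult_ac)
qed

text \<open>The multipliers are arbitrary here; that \<open>xe\<close> is a critical point of
  \<open>F\<close> is assumed only where it enters.\<close>

locale casimir_system =
  fixes \<Omega> :: "((real,'n::{finite,wellorder}) vec) set" and \<nu> C H and lam :: "nat \<Rightarrow> real" and xe
  assumes n2: "CARD('n) \<ge> 2" and op: "open \<Omega>" and \<nu>: "smooth_on \<Omega> \<nu>" and H: "smooth_on \<Omega> H"
    and C: "\<And>k. k \<in> {1..CARD('n) - 2} \<Longrightarrow> smooth_on \<Omega> (C k)" and xe: "xe \<in> \<Omega>"
begin

abbreviation "F \<equiv> F_lam (CARD('n) - 2) lam C H"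
abbreviation "X \<equiv> vfield \<nu> C H"

lemma F_lam_has_derivative_grad:
  assumes y: "y \<in> \<Omega>"
  shows "(F has_derivative (\<lambda>h. inner (grad F y) h)) (at y)"
    and "grad F y = grad H y + (\<Sum>k=1..CARD('n) - 2. lam k *\<^sub>R grad (C k) y)"
proof -
  have *: "(F has_derivative (\<lambda>h. inner (grad H y + (\<Sum>k=1..CARD('n) - 2. lam k *\<^sub>R grad (C k) y)) h)) (at y)"
    unfolding F_lam_def
    by (rule derivative_eq_intros smooth_on_has_derivative[OF H op y] smooth_on_has_derivative[OF C op y]
        refl | assumption)+
      (simp add: inner_add_left inner_sum_left)
  show eq: "grad F y = grad H y + (\<Sum>k=1..CARD('n) - 2. lam k *\<^sub>R grad (C k) y)"
    by (rule grad_eqI[OF *])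
  show "(F has_derivative (\<lambda>h. inner (grad F y) h)) (at y)" using * unfolding eq .
qed

lemma F_lam_grad_has_derivative: "(grad F has_derivative (*v) (hess F xe)) (at xe)"
proof (rule has_derivative_grad_hess)
  let ?g = "\<lambda>y. grad H y + (\<Sum>k=1..CARD('n) - 2. lam k *\<^sub>R grad (C k) y)"
  have "?g differentiable (at xe)"
    by (intro differentiable_add differentiable_sum differentiable_scaleR differentiable_const ballI
        smooth_on_grad_differentiable[OF H op xe] smooth_on_grad_differentiable[OF C op xe]) auto
  then obtain D where "(?g has_derivative D) (at xe)" by (auto simp: differentiable_def)
  then have "(grad F has_derivative D) (at xe)"
    by (rule has_derivative_transform_within_open[OF _ op xe]) (simp add: F_lam_has_derivative_grad(2))
  then show "grad F differentiable (at xe)" by (auto simp: differentiable_def)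
qed

text \<open>Adding combinations of the Casimir gradients to the last row does not change the
  determinant, so \<open>F\<close> generates the same field as \<open>H\<close>.\<close>

lemma vfield_inner_F_lam:
  assumes y: "y \<in> \<Omega>"
  shows "inner (X y) w = \<nu> y * det (frame (\<lambda>k. grad (C k) y) w (grad F y))"
proof -
  let ?c = "\<lambda>k. grad (C k) y"
  have "(\<Sum>k=1..CARD('n) - 2. lam k *\<^sub>R ?c k) \<in> span (?c ` {1..CARD('n) - 2})"
    by (intro span_sum span_scale span_base) auto
  then have "det (frame ?c w (\<Sum>k=1..CARD('n) - 2. lam k *\<^sub>R ?c k)) = 0" by (rule det_frame_span2[OF n2])
  then show ?thesis
    unfolding vfield_inner[OF n2] F_lam_has_derivative_grad(2)[OF y]
    by (simp add: linear_add[OF linear_det_frame2[OF n2]])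
qed

lemma vfield_first_integrals:
  assumes y: "y \<in> \<Omega>"
  shows "inner (grad F y) (X y) = 0"
    and "k \<in> {1..CARD('n) - 2} \<Longrightarrow> inner (grad (C k) y) (X y) = 0"
proof -
  show "inner (grad F y) (X y) = 0"
    by (simp add: inner_commute[of _ "X y"] vfield_inner_F_lam[OF y] det_frame_same[OF n2])
  assume "k \<in> {1..CARD('n) - 2}"
  then have "det (frame (\<lambda>k. grad (C k) y) (grad (C k) y) (grad F y)) = 0"
    by (intro det_frame_span1[OF n2] span_base) auto
  then show "inner (grad (C k) y) (X y) = 0"
    by (simp add: inner_commute[of _ "X y"] vfield_inner_F_lam[OF y])
qed

lemma vfield_lipschitz:
  assumes S: "compact S" "convex S" "S \<subseteq> \<Omega>"
  shows "\<exists>L. L-lipschitz_on S X"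
proof (rule lipschitz_on_vec)
  fix i
  have const: "\<exists>L. L-lipschitz_on S (\<lambda>x. c)" for c :: real
    by (auto intro: exI[of _ 0] lipschitz_on_constant)
  have gr: "\<exists>L. L-lipschitz_on S (\<lambda>y. grad f y $ l)" if "smooth_on \<Omega> f" for f l
    using smooth_on_lipschitz[OF smooth_on_partial[OF that] op S] by (simp add: grad_def)
  have "\<exists>L. L-lipschitz_on S (\<lambda>y. frame (\<lambda>k. grad (C k) y) (axis i 1) (grad H y) $ a $ b)" for a b
  proof -
    consider "pos a < CARD('n) - 2" | "pos a = CARD('n) - 2" | "pos a > CARD('n) - 2" by linarith
    then show ?thesis
      by cases (simp_all add: frame_def gr[OF C] gr[OF H] const)
  qed
  then have "\<exists>L. L-lipschitz_on S (\<lambda>y. \<nu> y * jac_det C H i y)"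
    unfolding jac_det_frame
    by (intro lipschitz_on_mult_compact lipschitz_on_det smooth_on_lipschitz[OF \<nu> op] S)
  then show "\<exists>L. L-lipschitz_on S (\<lambda>y. X y $ i)" by (simp add: vfield_def)
qed

text \<open>The last row vanishes at \<open>xe\<close>, so the product rule retains only the term in
  which this row is differentiated; the derivatives of \<open>\<nu>\<close> and of the other rows
  drop out.\<close>

lemma vfield_has_derivative:
  assumes F0: "grad F xe = 0" and b: "complement_basis (\<lambda>k. grad (C k) xe) e f"
  shows "(X has_derivative (\<lambda>h. (\<nu> xe * det (frame (\<lambda>k. grad (C k) xe) e f)) *\<^sub>R
      (inner (hess F xe *v h) f *\<^sub>R e - inner (hess F xe *v h) e *\<^sub>R f))) (at xe)"
    (is "(X has_derivative ?D) (at xe)")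
proof (rule has_derivative_vec)
  fix i
  let ?A = "hess F xe"
  define P where "P y z = \<nu> y * det (frame (\<lambda>k. grad (C k) y) (axis i 1) z)" for y z
  have linP: "linear (P y)" for y
    unfolding P_def using linear_compose_scale_right[OF linear_det_frame2[OF n2]] by simp
  \<comment> \<open>Expanding the last row makes the component a sum of products of two real
    functions, to which the ordinary product rule applies.\<close>
  have exp: "P y z = (\<Sum>l\<in>UNIV. z $ l * P y (axis l 1))" for y z
  proof -
    have "P y z = P y (\<Sum>l\<in>UNIV. z $ l *s axis l 1)" by (simp add: basis_expansion)
    then show ?thesis by (simp add: linear_sum[OF linP] linear_scale[OF linP] scalar_mult_eq_scaleR)
  qed
  have XP: "X y $ i = P y (grad F y)" if "y \<in> \<Omega>" for y
    using vfield_inner_F_lam[OF that, of "axis i 1"] by (simp add: P_def inner_axis)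
  have gr: "(\<lambda>y. grad (C k) y $ l) differentiable (at xe)" if "k \<in> {1..CARD('n) - 2}" for k l
    using smooth_on_differentiable[OF smooth_on_partial[OF C[OF that]] op xe] by (simp add: grad_def)
  have "(\<lambda>y. frame (\<lambda>k. grad (C k) y) (axis i 1) z $ a $ b) differentiable (at xe)" for z a b
  proof -
    consider "pos a < CARD('n) - 2" | "pos a = CARD('n) - 2" | "pos a > CARD('n) - 2" by linarith
    then show ?thesis by cases (simp_all add: frame_def gr)
  qed
  then have "(\<lambda>y. P y z) differentiable (at xe)" for z
    unfolding P_def by (intro differentiable_mult differentiable_det smooth_on_differentiable[OF \<nu> op xe])
  then have P': "((\<lambda>y. P y (axis l 1)) has_derivative frechet_derivative (\<lambda>y. P y (axis l 1)) (at xe)) (at xe)" for l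
    unfolding frechet_derivative_works by blast
  have gl: "((\<lambda>y. grad F y $ l) has_derivative (\<lambda>h. (?A *v h) $ l)) (at xe)" for l
    by (rule bounded_linear.has_derivative[OF bounded_linear_vec_nth F_lam_grad_has_derivative])
  have "((\<lambda>y. \<Sum>l\<in>UNIV. grad F y $ l * P y (axis l 1)) has_derivative
      (\<lambda>h. \<Sum>l\<in>UNIV. grad F xe $ l * frechet_derivative (\<lambda>y. P y (axis l 1)) (at xe) h + (?A *v h) $ l * P xe (axis l 1))) (at xe)"
    by (intro has_derivative_sum has_derivative_mult gl P')
  then have "((\<lambda>y. P y (grad F y)) has_derivative (\<lambda>h. P xe (?A *v h))) (at xe)"
    by (subst exp, subst exp[of xe]) (simp add: F0)
  then have "((\<lambda>y. X y $ i) has_derivative (\<lambda>h. P xe (?A *v h))) (at xe)"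
    by (rule has_derivative_transform_within_open[OF _ op xe]) (simp add: XP)
  moreover have "P xe (?A *v h) = ?D h $ i" for h
    unfolding P_def det_frame_complement_basis[OF n2 b, of "axis i 1"]
    by (simp add: inner_axis' algebra_simps)
  ultimately show "((\<lambda>y. X y $ i) has_derivative (\<lambda>h. ?D h $ i)) (at xe)" by simp
qed

section \<open>Stability decided by the Hessian on the plane\<close>

context
  fixes e f
  assumes F0: "grad F xe = 0" and b: "complement_basis (\<lambda>k. grad (C k) xe) e f"
begin

lemma F_lam_hess_symmetric: "inner (hess F xe *v u) v = inner (hess F xe *v v) u"
proof -
  obtain r where r: "0 < r" "ball xe r \<subseteq> \<Omega>" using op xe open_contains_ball by blast
  show ?thesis
    by (rule second_derivative_symmetric[OF r(1) F_lam_has_derivative_grad(1) F_lam_grad_has_derivative])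
      (use r in auto)
qed

text \<open>Definiteness on the plane makes \<open>q\<close> positive away from 0, the absolute
  value covering both signs. At another nearby point of the level set the expansions of
  \<open>F\<close> and the \<open>C k\<close> would make \<open>q\<close> too small.\<close>

lemma isolated_in_level_set:
  assumes def: "0 < inner (hess F xe *v e) e * inner (hess F xe *v f) f - (inner (hess F xe *v e) f)\<^sup>2"
  obtains r where "0 < r" "\<And>y. y \<in> cball xe r \<Longrightarrow> F y = F xe \<Longrightarrow>
    (\<And>k. k \<in> {1..CARD('n) - 2} \<Longrightarrow> C k y = C k xe) \<Longrightarrow> y = xe"
proof -
  let ?A = "hess F xe" and ?I = "{1..CARD('n) - 2}" and ?c = "\<lambda>k. grad (C k) xe"
  define q where "q h = \<bar>inner (?A *v h) h\<bar> + (\<Sum>k\<in>?I. (inner (?c k) h)\<^sup>2)" for h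
  have "0 < q h" if "h \<noteq> 0" for h
  proof (rule ccontr)
    assume "\<not> 0 < q h"
    moreover have "0 \<le> (\<Sum>k\<in>?I. (inner (?c k) h)\<^sup>2)" by (rule sum_nonneg) simp
    ultimately have Ah: "inner (?A *v h) h = 0" and s: "(\<Sum>k\<in>?I. (inner (?c k) h)\<^sup>2) = 0"
      unfolding q_def by auto
    have ck: "inner (?c k) h = 0" if "k \<in> ?I" for k
      using s that by (subst (asm) sum_nonneg_eq_0_iff) auto
    define \<alpha> \<beta> where "\<alpha> = inner h e" and "\<beta> = inner h f"
    have "h - \<alpha> *\<^sub>R e - \<beta> *\<^sub>R f = 0"
      by (rule complement_basis_eq_0[OF b])
        (use b ck in \<open>auto simp: complement_basis_def \<alpha>_def \<beta>_def inner_diff_left inner_diff_right inner_commute[of f e]\<close>)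
    then have h: "h = \<alpha> *\<^sub>R e + \<beta> *\<^sub>R f" by (simp add: algebra_simps)
    define a b c where "a = inner (?A *v e) e" and "b = inner (?A *v e) f" and "c = inner (?A *v f) f"
    have "0 = a * \<alpha>\<^sup>2 + 2 * b * \<alpha> * \<beta> + c * \<beta>\<^sup>2"
      using Ah unfolding h
      by (simp add: matrix_vector_right_distrib matrix_vector_mult_scaleR inner_add_left inner_add_right
          F_lam_hess_symmetric[of f e] a_def b_def c_def power2_eq_square algebra_simps)
    moreover have d: "0 < a * c - b\<^sup>2" using def by (simp add: a_def b_def c_def)
    \<comment> \<open>Completing the square after multiplication by \<open>a\<close> avoids a
      distinction by the sign of \<open>a\<close>.\<close>
    moreover have "a * (a * \<alpha>\<^sup>2 + 2 * b * \<alpha> * \<beta> + c * \<beta>\<^sup>2) = (a * \<alpha> + b * \<beta>)\<^sup>2 + (a * c - b\<^sup>2) * \<beta>\<^sup>2"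
      by (simp add: power2_eq_square algebra_simps)
    ultimately have *: "(a * \<alpha> + b * \<beta>)\<^sup>2 + (a * c - b\<^sup>2) * \<beta>\<^sup>2 = 0" by simp
    moreover have "0 \<le> (a * c - b\<^sup>2) * \<beta>\<^sup>2" using d by simp
    ultimately have "(a * c - b\<^sup>2) * \<beta>\<^sup>2 = 0" "(a * \<alpha> + b * \<beta>)\<^sup>2 = 0"
      using zero_le_power2[of "a * \<alpha> + b * \<beta>"] by linarith+
    then have "\<beta> = 0" "a * \<alpha> = 0" using d by auto
    moreover have "a \<noteq> 0" using d zero_le_power2[of b] by (auto simp del: zero_le_power2)
    ultimately show False using h that by simp
  qed
  moreover have "continuous_on UNIV q" unfolding q_def
    by (intro continuous_intros linear_continuous_on matrix_vector_mul_bounded_linear)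
  moreover have "q (s *\<^sub>R h) = s\<^sup>2 * q h" for s h
    by (simp add: q_def matrix_vector_mult_scaleR power_mult_distrib abs_mult power2_eq_square
        sum_distrib_left algebra_simps)
  ultimately obtain \<alpha> where \<alpha>: "0 < \<alpha>" "\<And>h. \<alpha> * (norm h)\<^sup>2 \<le> q h"
    using quadratic_coercive[of q] by blast
  define m where "m = real (card ?I)"
  \<comment> \<open>On the level set the quadratic term of \<open>F\<close> is at most
    \<open>2 * \<eta>\<close> times the squared norm, and each of the \<open>m\<close> squares at
    most \<open>\<eta>\<close> times it because \<open>\<eta> \<le> 1\<close>; the total must stay
    below \<alpha>.\<close>
  define \<eta> where "\<eta> = min 1 (\<alpha> / (2 * (2 + m)))"
  have m: "0 \<le> m" by (simp add: m_def)
  have \<eta>: "0 < \<eta>" "\<eta> \<le> 1" "\<eta> * (2 + m) < \<alpha>"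
  proof -
    show "0 < \<eta>" "\<eta> \<le> 1" using \<alpha> m by (auto simp: \<eta>_def)
    have "\<eta> * (2 + m) \<le> \<alpha> / (2 * (2 + m)) * (2 + m)" using m by (intro mult_right_mono) (auto simp: \<eta>_def)
    also have "\<dots> = \<alpha> / 2" using m by (simp add: field_simps)
    finally show "\<eta> * (2 + m) < \<alpha>" using \<alpha> by simp
  qed
  obtain r0 where r0: "0 < r0" "ball xe r0 \<subseteq> \<Omega>" using op xe open_contains_ball by blast
  obtain d where d: "0 < d" "\<And>h. norm h < d \<Longrightarrow>
      \<bar>F (xe + h) - F xe - inner (grad F xe) h - inner (?A *v h) h / 2\<bar> \<le> \<eta> * (norm h)\<^sup>2"
    using taylor_second_order[OF r0(1) F_lam_has_derivative_grad(1)[OF subsetD[OF r0(2)]]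
        F_lam_grad_has_derivative \<eta>(1)] by blast
  have "\<exists>d>0. \<forall>h. norm h < d \<longrightarrow> \<bar>C k (xe + h) - C k xe - inner (?c k) h\<bar> \<le> \<eta> * norm h" if "k \<in> ?I" for k
    using has_derivative_bound[OF smooth_on_has_derivative[OF C[OF that] op xe] \<eta>(1)] by (metis real_norm_def)
  then obtain dk where dk: "\<And>k. k \<in> ?I \<Longrightarrow> 0 < dk k" "\<And>k h. k \<in> ?I \<Longrightarrow> norm h < dk k \<Longrightarrow>
      \<bar>C k (xe + h) - C k xe - inner (?c k) h\<bar> \<le> \<eta> * norm h"
    by metis
  \<comment> \<open>Inserting \<open>d\<close> keeps the set nonempty for n = 2.\<close>
  define \<rho> where "\<rho> = Min (insert d (dk ` ?I))"
  have \<rho>: "0 < \<rho>" "\<rho> \<le> d"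
    unfolding \<rho>_def using d(1) dk(1) by (subst Min_gr_iff) auto
  have \<rho>_dk: "\<rho> \<le> dk k" if "k \<in> ?I" for k
    unfolding \<rho>_def using that by (intro Min_le) blast+
  have "y = xe" if y: "y \<in> cball xe (\<rho> / 2)" and Fy: "F y = F xe" and Cy: "\<And>k. k \<in> ?I \<Longrightarrow> C k y = C k xe" for y
  proof (rule ccontr)
    assume "y \<noteq> xe"
    define h where "h = y - xe"
    have h0: "h \<noteq> 0" and yh: "y = xe + h" using \<open>y \<noteq> xe\<close> by (auto simp: h_def)
    have nh: "norm h < \<rho>" using y \<rho>(1) by (simp add: h_def dist_norm norm_minus_commute)
    have "\<bar>inner (?A *v h) h\<bar> \<le> 2 * \<eta> * (norm h)\<^sup>2" using d(2)[of h] nh \<rho> Fy by (simp add: yh F0)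
    moreover have "(\<Sum>k\<in>?I. (inner (?c k) h)\<^sup>2) \<le> (\<Sum>k\<in>?I. \<eta> * (norm h)\<^sup>2)"
    proof (rule sum_mono)
      fix k assume k: "k \<in> ?I"
      have "\<bar>inner (?c k) h\<bar> \<le> \<eta> * norm h" using dk(2)[OF k, of h] nh \<rho>_dk[OF k] Cy[OF k] by (simp add: yh)
      then have "(inner (?c k) h)\<^sup>2 \<le> (\<eta> * norm h)\<^sup>2" by (rule power2_le_iff_abs_le[THEN iffD2, rotated]) (use \<eta> in auto)
      also have "\<dots> \<le> \<eta> * (norm h)\<^sup>2"
        unfolding power_mult_distrib using \<eta>
        by (intro mult_right_mono) (auto simp: power2_eq_square mult_left_le)
      finally show "(inner (?c k) h)\<^sup>2 \<le> \<eta> * (norm h)\<^sup>2" .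
    qed
    ultimately have "q h \<le> 2 * \<eta> * (norm h)\<^sup>2 + m * (\<eta> * (norm h)\<^sup>2)" by (simp add: q_def m_def)
    also have "\<dots> = \<eta> * (2 + m) * (norm h)\<^sup>2" by (simp add: algebra_simps)
    also have "\<dots> < \<alpha> * (norm h)\<^sup>2" using \<eta>(3) h0 by simp
    finally show False using \<alpha>(2)[of h] by simp
  qed
  then show ?thesis using that[of "\<rho> / 2"] \<rho> by auto
qed

text \<open>For a sum of squared deviations, a strict minimum at \<open>xe\<close> is the same as
  isolation in the common level set.\<close>

lemma vfield_lyapunov_stable:
  assumes def: "0 < inner (hess F xe *v e) e * inner (hess F xe *v f) f - (inner (hess F xe *v e) f)\<^sup>2"
  shows "lyapunov_stable X \<Omega> xe"
proof -
  let ?I = "{1..CARD('n) - 2}"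
  obtain r1 where r1: "0 < r1" "\<And>y. y \<in> cball xe r1 \<Longrightarrow> F y = F xe \<Longrightarrow>
    (\<And>k. k \<in> ?I \<Longrightarrow> C k y = C k xe) \<Longrightarrow> y = xe"
    using isolated_in_level_set[OF def] by blast
  obtain r2 where r2: "0 < r2" "cball xe r2 \<subseteq> \<Omega>" using op xe open_contains_cball by blast
  define r where "r = min r1 r2"
  have r: "0 < r" "cball xe r \<subseteq> \<Omega>" using r1 r2 by (auto simp: r_def)
  obtain L where L: "L-lipschitz_on (cball xe r) X" using vfield_lipschitz[of "cball xe r"] r by auto
  define V where "V y = (F y - F xe)\<^sup>2 + (\<Sum>k\<in>?I. (C k y - C k xe)\<^sup>2)" for y
  define V' where "V' y v = 2 * (F y - F xe) * inner (grad F y) v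
      + (\<Sum>k\<in>?I. 2 * (C k y - C k xe) * inner (grad (C k) y) v)" for y v
  show ?thesis
  proof (rule lyapunov_stable_first_integral[OF r L, of V V'])
    fix y assume y: "y \<in> cball xe r"
    then have y\<Omega>: "y \<in> \<Omega>" using r by auto
    show "(V has_derivative V' y) (at y)"
      unfolding V_def V'_def
      by (rule derivative_eq_intros F_lam_has_derivative_grad(1)[OF y\<Omega>]
          smooth_on_has_derivative[OF C op y\<Omega>] refl | assumption)+
        (simp add: algebra_simps)
    show "V' y (X y) = 0" by (simp add: V'_def vfield_first_integrals[OF y\<Omega>])
    assume ne: "y \<noteq> xe"
    show "V xe < V y"
    proof (rule ccontr)
      assume "\<not> V xe < V y"
      then have "V y \<le> 0" by (simp add: V_def)
      moreover have nn: "0 \<le> (\<Sum>k\<in>?I. (C k y - C k xe)\<^sup>2)" by (rule sum_nonneg) simp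
      ultimately have "(F y - F xe)\<^sup>2 = 0" and s: "(\<Sum>k\<in>?I. (C k y - C k xe)\<^sup>2) = 0"
        using zero_le_power2[of "F y - F xe"] unfolding V_def by linarith+
      moreover have "C k y = C k xe" if "k \<in> ?I" for k
        using s that by (subst (asm) sum_nonneg_eq_0_iff) auto
      ultimately have "y = xe" using y by (intro r1(2)) (auto simp: r_def)
      then show False using ne by simp
    qed
  qed
qed

lemma vfield_unstable:
  assumes \<nu>0: "\<nu> xe \<noteq> 0"
    and indef: "inner (hess F xe *v e) e * inner (hess F xe *v f) f - (inner (hess F xe *v e) f)\<^sup>2 < 0"
  shows "unstable X \<Omega> xe"
proof -
  let ?A = "hess F xe" and ?I = "{1..CARD('n) - 2}" and ?c = "\<lambda>k. grad (C k) xe"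
  define \<kappa> where "\<kappa> = \<nu> xe * det (frame ?c e f)"
  define D where "D h = \<kappa> *\<^sub>R (inner (?A *v h) f *\<^sub>R e - inner (?A *v h) e *\<^sub>R f)" for h
  have \<kappa>: "\<kappa> \<noteq> 0" using \<nu>0 det_frame_nonzero[OF n2 b] by (simp add: \<kappa>_def)
  define a b' c where "a = inner (?A *v e) e" and "b' = inner (?A *v e) f" and "c = inner (?A *v f) f"
  have fe: "inner (?A *v f) e = b'" using F_lam_hess_symmetric by (simp add: b'_def)
  define d where "d = b'\<^sup>2 - a * c"
  have d: "0 < d" using indef by (simp add: d_def a_def b'_def c_def)
  \<comment> \<open>\<open>D h\<close> depends only on these two numbers, and in them
    \<open>D\<close> acts as a 2 by 2 matrix of trace 0 and determinant
    \<open>- \<kappa>\<^sup>2 * d\<close>.\<close>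
  define z1 z2 where "z1 h = inner (?A *v h) e" and "z2 h = inner (?A *v h) f" for h
  have z_lin: "z1 (h + k) = z1 h + z1 k" "z2 (h + k) = z2 h + z2 k"
    "z1 (s *\<^sub>R h) = s * z1 h" "z2 (s *\<^sub>R h) = s * z2 h" for h k s
    by (simp_all add: z1_def z2_def matrix_vector_right_distrib matrix_vector_mult_scaleR inner_add_left)
  have z_ef: "z1 e = a" "z2 e = b'" "z1 f = b'" "z2 f = c"
    by (simp_all add: z1_def z2_def a_def b'_def c_def fe[unfolded b'_def])
  have D_eq: "D h = (\<kappa> * z2 h) *\<^sub>R e + (- \<kappa> * z1 h) *\<^sub>R f" for h
    by (simp add: D_def z1_def z2_def algebra_simps)
  have zD: "z1 (D h) = \<kappa> * (a * z2 h - b' * z1 h)" "z2 (D h) = \<kappa> * (b' * z2 h - c * z1 h)" for h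
    unfolding D_eq z_lin z_ef by (simp_all add: algebra_simps)
  have ck: "inner (?c k) e = 0" "inner (?c k) f = 0" if "k \<in> ?I" for k
    using b that by (auto simp: complement_basis_def)
  have cD: "inner (?c k) (D h) = 0" if "k \<in> ?I" for k h
    using ck[OF that] unfolding D_eq by (simp add: inner_diff_right)
  \<comment> \<open>Not symmetrized: only its diagonal and the sum
    \<open>B h (D h) + B (D h) h\<close> matter. Subtracting the squares makes positivity of
    \<open>B h h\<close> control the component of \<open>h\<close> across the plane.\<close>
  define B where "B h k = \<kappa> * (b' * (z2 h * z2 k - z1 h * z1 k) + (a - c) * (z1 h * z2 k))
      - (\<Sum>i\<in>?I. inner (?c i) h * inner (?c i) k)" for h k
  have "bilinear B"
    unfolding bilinear_def linear_iff B_def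
    by (simp add: z_lin inner_add_right sum.distrib sum_distrib_left algebra_simps)
  then have bbl: "bounded_bilinear B" by (simp add: bilinear_conv_bounded_bilinear)
  have sum_lt: "(\<Sum>i\<in>?I. (inner (?c i) h)\<^sup>2) < \<kappa> * (b' * ((z2 h)\<^sup>2 - (z1 h)\<^sup>2) + (a - c) * (z1 h * z2 h))"
    if "0 < B h h" for h
    using that by (simp add: B_def power2_eq_square)
  have BD: "\<kappa>\<^sup>2 * d * ((z1 h)\<^sup>2 + (z2 h)\<^sup>2) \<le> B h (D h) + B (D h) h" for h
  proof -
    \<comment> \<open>The Casimir terms drop out because \<open>D h\<close> is orthogonal to their
      gradients; what remains is a sum of squares.\<close>
    have "B h (D h) + B (D h) h = \<kappa>\<^sup>2 * (d * ((z1 h)\<^sup>2 + (z2 h)\<^sup>2)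
        + (b' * z1 h - a * z2 h)\<^sup>2 + (c * z1 h - b' * z2 h)\<^sup>2)"
      by (simp add: B_def cD zD d_def power2_eq_square algebra_simps)
    then show ?thesis by (simp add: mult.assoc mult_left_mono)
  qed
  define q where "q h = (z1 h)\<^sup>2 + (z2 h)\<^sup>2 + (\<Sum>i\<in>?I. (inner (?c i) h)\<^sup>2)" for h
  have "0 < q h" if "h \<noteq> 0" for h
  proof (rule ccontr)
    assume "\<not> 0 < q h"
    moreover have "0 \<le> (\<Sum>i\<in>?I. (inner (?c i) h)\<^sup>2)" by (rule sum_nonneg) simp
    ultimately have "(z1 h)\<^sup>2 = 0" "(z2 h)\<^sup>2 = 0" and s: "(\<Sum>i\<in>?I. (inner (?c i) h)\<^sup>2) = 0"
      unfolding q_def using zero_le_power2[of "z1 h"] zero_le_power2[of "z2 h"] by linarith+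
    then have z0: "z1 h = 0" "z2 h = 0" by auto
    have ch: "inner (?c k) h = 0" if "k \<in> ?I" for k
      using s that by (subst (asm) sum_nonneg_eq_0_iff) auto
    define \<alpha> \<beta> where "\<alpha> = inner h e" and "\<beta> = inner h f"
    have "h - \<alpha> *\<^sub>R e - \<beta> *\<^sub>R f = 0"
      by (rule complement_basis_eq_0[OF b])
        (use b ch in \<open>auto simp: complement_basis_def \<alpha>_def \<beta>_def inner_diff_left inner_diff_right inner_commute[of f e]\<close>)
    then have h: "h = \<alpha> *\<^sub>R e + \<beta> *\<^sub>R f" by (simp add: algebra_simps)
    have e1: "\<alpha> * a + \<beta> * b' = 0" and e2: "\<alpha> * b' + \<beta> * c = 0"
      using z0 unfolding h z_lin z_ef by auto
    \<comment> \<open>Cramer's rule for the symmetric matrix with entries \<open>a\<close>,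
      \<open>b'\<close>, \<open>c\<close>, whose determinant is \<open>- d\<close>.\<close>
    have "d * \<alpha> = b' * (\<alpha> * b' + \<beta> * c) - c * (\<alpha> * a + \<beta> * b')"
      "d * \<beta> = b' * (\<alpha> * a + \<beta> * b') - a * (\<alpha> * b' + \<beta> * c)"
      by (simp_all add: d_def power2_eq_square algebra_simps)
    then have "\<alpha> = 0" "\<beta> = 0" using e1 e2 d by auto
    then show False using h that by simp
  qed
  moreover have "continuous_on UNIV q" unfolding q_def z1_def z2_def
    by (intro continuous_intros linear_continuous_on matrix_vector_mul_bounded_linear)
  moreover have "q (s *\<^sub>R h) = s\<^sup>2 * q h" for s h
    by (simp add: q_def z_lin power_mult_distrib sum_distrib_left algebra_simps)
  ultimately obtain \<alpha> where \<alpha>: "0 < \<alpha>" "\<And>h. \<alpha> * (norm h)\<^sup>2 \<le> q h"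
    using quadratic_coercive[of q] by blast
  \<comment> \<open>Bounds the planar part of \<open>B h h\<close> by \<open>K\<close> times the sum
    of the squares of \<open>z1 h\<close> and \<open>z2 h\<close>.\<close>
  define K where "K = \<bar>\<kappa>\<bar> * (\<bar>b'\<bar> + \<bar>a - c\<bar>)"
  have K: "0 \<le> K" by (simp add: K_def)
  have qK: "q h \<le> (1 + K) * ((z1 h)\<^sup>2 + (z2 h)\<^sup>2)" if "0 < B h h" for h
  proof -
    let ?s = "(z1 h)\<^sup>2 + (z2 h)\<^sup>2"
    have 1: "\<bar>(z2 h)\<^sup>2 - (z1 h)\<^sup>2\<bar> \<le> ?s" by (simp add: abs_le_iff)
    have 2: "\<bar>z1 h * z2 h\<bar> \<le> ?s"
      using sum_squares_bound[of "\<bar>z1 h\<bar>" "\<bar>z2 h\<bar>"] abs_ge_zero[of "z1 h * z2 h"]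
      unfolding abs_mult power2_abs mult.assoc by linarith
    have "\<kappa> * (b' * ((z2 h)\<^sup>2 - (z1 h)\<^sup>2) + (a - c) * (z1 h * z2 h))
        \<le> \<bar>\<kappa> * (b' * ((z2 h)\<^sup>2 - (z1 h)\<^sup>2) + (a - c) * (z1 h * z2 h))\<bar>" by simp
    also have "\<dots> = \<bar>\<kappa>\<bar> * \<bar>b' * ((z2 h)\<^sup>2 - (z1 h)\<^sup>2) + (a - c) * (z1 h * z2 h)\<bar>" by (rule abs_mult)
    also have "\<dots> \<le> \<bar>\<kappa>\<bar> * (\<bar>b'\<bar> * ?s + \<bar>a - c\<bar> * ?s)"
      using 1 2 by (intro mult_left_mono order_trans[OF abs_triangle_ineq] add_mono)
        (auto simp: abs_mult intro!: mult_left_mono)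
    also have "\<dots> = K * ?s" by (simp add: K_def algebra_simps)
    finally show ?thesis using sum_lt[OF that] by (simp add: q_def algebra_simps)
  qed
  define \<mu> where "\<mu> = \<kappa>\<^sup>2 * d * \<alpha> / (1 + K)"
  have \<mu>: "0 < \<mu>" using \<kappa> d \<alpha> K by (simp add: \<mu>_def)
  have grow: "\<mu> * (norm h)\<^sup>2 \<le> B h (D h) + B (D h) h" if "0 < B h h" for h
  proof -
    have "\<alpha> * (norm h)\<^sup>2 \<le> (1 + K) * ((z1 h)\<^sup>2 + (z2 h)\<^sup>2)" using \<alpha>(2)[of h] qK[OF that] by simp
    then have "\<kappa>\<^sup>2 * d / (1 + K) * (\<alpha> * (norm h)\<^sup>2) \<le> \<kappa>\<^sup>2 * d / (1 + K) * ((1 + K) * ((z1 h)\<^sup>2 + (z2 h)\<^sup>2))"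
      using d K by (intro mult_left_mono) auto
    also have "\<dots> = \<kappa>\<^sup>2 * d * ((z1 h)\<^sup>2 + (z2 h)\<^sup>2)" using K by simp
    also note BD
    finally show ?thesis by (simp add: \<mu>_def)
  qed
  have "\<exists>v. 0 < B v v"
  proof -
    \<comment> \<open>Solves the same 2 by 2 system within the plane, so \<open>z1\<close> and
      \<open>z2\<close> can be prescribed there.\<close>
    have onto: "\<exists>v. z1 v = x \<and> z2 v = y \<and> (\<forall>k\<in>?I. inner (?c k) v = 0)" for x y
    proof (intro exI conjI ballI)
      let ?v = "((b' * y - c * x) / d) *\<^sub>R e + ((b' * x - a * y) / d) *\<^sub>R f"
      have "z1 ?v = ((b' * y - c * x) * a + (b' * x - a * y) * b') / d" "z2 ?v = ((b' * y - c * x) * b' + (b' * x - a * y) * c) / d"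
        unfolding z_lin z_ef by (simp_all add: add_divide_distrib)
      moreover have "(b' * y - c * x) * a + (b' * x - a * y) * b' = x * d" "(b' * y - c * x) * b' + (b' * x - a * y) * c = y * d"
        by (simp_all add: d_def power2_eq_square algebra_simps)
      ultimately show "z1 ?v = x" "z2 ?v = y" using d by auto
      show "inner (?c k) ?v = 0" if "k \<in> ?I" for k using ck[OF that] by (simp add: inner_add_right)
    qed
    have val: "\<exists>v. B v v = \<kappa> * (b' * (y\<^sup>2 - x\<^sup>2) + (a - c) * (x * y))" for x y
    proof -
      obtain v where "z1 v = x" "z2 v = y" "\<forall>k\<in>?I. inner (?c k) v = 0" using onto by blast
      then show ?thesis by (intro exI[of _ v]) (simp add: B_def power2_eq_square)
    qed
    \<comment> \<open>Otherwise \<open>d\<close> would be minus a square. The four sign cases take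
      (z1, z2) to be (0,1), (1,0), (1,1) and (1,-1).\<close>
    have "b' \<noteq> 0 \<or> a \<noteq> c" using d zero_le_square[of c] by (auto simp: d_def power2_eq_square)
    then consider "0 < \<kappa> * b'" | "\<kappa> * b' < 0" | "0 < \<kappa> * (a - c)" | "\<kappa> * (a - c) < 0"
      using \<kappa> by (metis linorder_neqE_linordered_idom mult_eq_0_iff right_minus_eq)
    then show ?thesis
    proof cases
      case 1
      obtain v where "B v v = \<kappa> * b'" using val[where x = 0 and y = 1] by auto
      with 1 show ?thesis by (intro exI[of _ v]) simp
    next
      case 2
      obtain v where "B v v = - (\<kappa> * b')" using val[where x = 1 and y = 0] by auto
      with 2 show ?thesis by (intro exI[of _ v]) simp
    next
      case 3
      obtain v where "B v v = \<kappa> * (a - c)" using val[of 1 1] by auto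
      with 3 show ?thesis by (intro exI[of _ v]) simp
    next
      case 4
      obtain v where "B v v = - (\<kappa> * (a - c))" using val[of 1 "-1"] by (auto simp: algebra_simps)
      with 4 show ?thesis by (intro exI[of _ v]) simp
    qed
  qed
  then obtain v where v: "0 < B v v" ..
  have X0: "X xe = 0"
  proof -
    have "inner (X xe) w = 0" for w
      by (simp add: vfield_inner_F_lam[OF xe] F0 linear_0[OF linear_det_frame2[OF n2]])
    then show ?thesis using inner_eq_zero_iff by blast
  qed
  have X': "(X has_derivative D) (at xe)"
    using vfield_has_derivative[OF F0 b] unfolding D_def \<kappa>_def .
  show ?thesis
    by (rule quadratic_chetaev_unstable[where B = B and D = D and \<alpha> = \<mu> and v = v])
      (fact X' X0 bbl \<mu> v grow)+
qed

end

end

theorem theorem5p7: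
  fixes \<Omega> :: "((real,'n::{finite,wellorder}) vec) set"
    and \<nu> :: "(real,'n) vec \<Rightarrow> real"
    and C :: "nat \<Rightarrow> (real,'n) vec \<Rightarrow> real"
    and H :: "(real,'n) vec \<Rightarrow> real"
    and lam :: "nat \<Rightarrow> real"
    and xe :: "(real,'n) vec"
  assumes n2: "CARD('n) \<ge> 2"
    and open\<Omega>: "open \<Omega>"
    and smooth\<nu>: "smooth_on \<Omega> \<nu>"
    and smoothC: "\<And>k. k \<in> {1..CARD('n) - 1} \<Longrightarrow> smooth_on \<Omega> (C k)"
    and H_def: "H = C (CARD('n) - 1)"
    and eq: "xe \<in> regular_equilibria \<Omega> \<nu> C H"
    and lam: "grad H xe + (\<Sum>k=1..CARD('n) - 2. lam k *\<^sub>R grad (C k) xe) = 0"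
    and nondeg: "det (hess (F_lam (CARD('n) - 2) lam C H) xe) \<noteq> 0"
  shows "(index_IX \<nu> C H lam xe < 0 \<longrightarrow> unstable (vfield \<nu> C H) \<Omega> xe)
       \<and> (index_IX \<nu> C H lam xe > 0 \<longrightarrow> lyapunov_stable (vfield \<nu> C H) \<Omega> xe)"
proof -
  let ?m = "CARD('n) - 2" and ?c = "\<lambda>k. grad (C k) xe"
  let ?A = "hess (F_lam ?m lam C H) xe"
  have xe: "xe \<in> \<Omega>" and \<nu>0: "\<nu> xe \<noteq> 0" and wedge: "wedge_nonzero ?m ?c"
    using eq by (auto simp: regular_equilibria_def)
  have H: "smooth_on \<Omega> H" unfolding H_def by (rule smoothC) (use n2 in auto)
  have C: "smooth_on \<Omega> (C k)" if "k \<in> {1..?m}" for k by (rule smoothC) (use that in auto)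
  interpret casimir_system \<Omega> \<nu> C H lam xe
    by unfold_locales (use n2 open\<Omega> smooth\<nu> H C xe in auto)
  have F0: "grad (F_lam ?m lam C H) xe = 0"
    using lam F_lam_has_derivative_grad(2)[OF xe] by simp
  obtain e f where b: "complement_basis ?c e f" using complement_basis_exists[OF n2 wedge] .
  let ?disc = "inner (?A *v e) e * inner (?A *v f) f - (inner (?A *v e) f)\<^sup>2"
  \<comment> \<open>Symmetry of the Hessian turns the product of off-diagonal entries into a square,
    so the index is a positive multiple of \<open>?disc\<close>.\<close>
  have "inner (?A *v f) e = inner (?A *v e) f"
    by (rule F_lam_hess_symmetric[OF F0 b])
  then have "index_IX \<nu> C H lam xe = (\<nu> xe * det (frame ?c e f))\<^sup>2 * ?disc"
    using det_wedge_inner_inverse[OF n2 b nondeg]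
    unfolding index_IX_def Let_def mult.assoc by (simp add: power_mult_distrib power2_eq_square)
  moreover have "0 < (\<nu> xe * det (frame ?c e f))\<^sup>2" using \<nu>0 det_frame_nonzero[OF n2 b] by simp
  ultimately have "index_IX \<nu> C H lam xe < 0 \<Longrightarrow> ?disc < 0" "0 < index_IX \<nu> C H lam xe \<Longrightarrow> 0 < ?disc"
    by (simp_all add: mult_less_0_iff zero_less_mult_iff)
  then show ?thesis
    using vfield_unstable[OF F0 b \<nu>0] vfield_lyapunov_stable[OF F0 b] by blast
qed

end
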